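(* Let $A=\bigoplus_{\omega\in\Omega}X_\omega^\dagger X_\omega$ be a point of the convex set $\mathsf{D}$ defined in the context, where for $\omega=(i,\nu_i)$ the operator $X_\omega$ acts on $\mathbb{C}^{m_{\nu_i}}$, and let $r_{i,\nu_i}\equiv r_\omega=\mathrm{rank}(X_\omega)$. If $A$ is an extreme point of $\mathsf{D}$, then $$\sum_{i\in\mathsf{I}}\ \sum_{\nu_i\in\mathsf{S}_i}r_{i,\nu_i}^2\ \le\ \sum_{\mu\in\mathsf{S}}m_\mu^2 .$$
   Context: $\mathbf{G}$ is a compact Lie group (finite groups included). $\mathcal{H}$ is a finite-dimensional complex Hilbert space and $\{U_g\mid g\in\mathbf{G}\}$ is a (generally projective) unitary representation of $\mathbf{G}$ on $\mathcal{H}$, with $g\mapsto U_gXU_g^\dagger$ continuous for every operator $X$. $\mathsf{S}$ is the set of equivalence classes of irreducible representations occurring in $\{U_g\}$; $\mathcal{H}=\bigoplus_{\mu\in\mathsf{S}}\bigoplus_{k=1}^{m_\mu}\mathcal{H}_k^\mu$ is a fixed orthogonal decomposition into irreducible subspaces, where $\mathcal{H}_k^\mu$ carries an irrep of class $\mu$, of dimension $d_\mu$, and $m_\mu$ is the multiplicity of $\mu$. For $k,l=1,\dots,m_\mu$, $T_{kl}^\mu$ is the invariant isomorphism $\mathcal{H}_l^\mu\to\mathcal{H}_k^\mu$: a partial isometry on $\mathcal{H}$ with support $\mathcal{H}_l^\mu$ and range $\mathcal{H}_k^\mu$, commuting with all $U_g$, chosen so that $T^\mu_{kk}$ is the orthogonal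 projection onto $\mathcal{H}^\mu_k$ and $T^\mu_{kl}T^\mu_{ln}=T^\mu_{kn}$. $\mathsf{I}$ is a finite index set and, for each $i\in\mathsf{I}$, $\mathbf{G}_i\subseteq\mathbf{G}$ is a compact subgroup. For each $i$, let $\mathsf{S}_i$ be the set of equivalence classes of irreps occurring in the restricted representation $\{U_h\mid h\in\mathbf{G}_i\}$, with multiplicities $m_{\nu_i}$, and let $\mathcal{H}=\bigoplus_{\nu_i\in\mathsf{S}_i}\mathcal{H}_{\nu_i}\otimes\mathbb{C}^{m_{\nu_i}}$ be the corresponding decomposition, with $U_h=\bigoplus_{\nu_i\in\mathsf{S}_i}U_h^{\nu_i}\otimes 1_{m_{\nu_i}}$ for $h\in\mathbf{G}_i$. Let $\Pi_{\nu_i}$ be the projector onto $\mathcal{H}_{\nu_i}\otimes\mathbb{C}^{m_{\nu_i}}$. Let $\Omega=\{(i,\nu_i)\mid i\in\mathsf{I},\ \nu_i\in\mathsf{S}_i\}$. For $\omega=(i,\nu_i)\in\Omega$ put $S_{kl\omega}^\mu=\mathrm{Tr}_{\mathcal{H}_{\nu_i}}[\Pi_{\nu_i}T_{kl}^\mu\Pi_{\nu_i}]$ (partial trace over $\mathcal{H}_{\nu_i}$, giving an operator on $\mathbb{C}^{m_{\nu_i}}$), and $S_{kl}^\mu=\bigoplus_{\omega\in\Omega}S_{kl\omega}^\mu$. The convex set $\mathsf{D}$ consists of all block operators $A=\bigoplus_{\omega\in\Omega}A_\omega$, with $A_{(i,\nu_i)}$ a linear operator on $\mathbb{C}^{m_{\nu_i}}$,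 such that $A\ge 0$ and $$\mathrm{Tr}[S_{kl}^\mu A]=\delta_{kl}\,d_\mu\qquad\forall\mu\in\mathsf{S},\ \forall k,l=1,\dots,m_\mu .$$ ($\mathsf{D}$ is in affine bijection with the covariant POVMs with outcome space $\bigcup_{i\in\mathsf{I}}\mathbf{G}/\mathbf{G}_i$, with density given on the orbit $\mathbf{G}/\mathbf{G}_i$ by $U_gA_iU_g^\dagger$, where $A_i=\bigoplus_{\nu_i\in\mathsf{S}_i}1_{\nu_i}\otimes A_{i,\nu_i}$.) *)

theory Defs
  imports
    "HOL-Analysis.Derivative"
    "HOL-Analysis.Abstract_Euclidean_Space"
    "HOL-Analysis.Abstract_Topological_Spaces"
    "HOL-Algebra.Group"
    "Jordan_Normal_Form.Schur_Decomposition"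
    "Jordan_Normal_Form.DL_Rank"
begin

section \<open>Compact Lie groups\<close>

text \<open>
  The model space is \<^const>\<open>Euclidean_space\<close> \<open>n\<close> with \<open>n\<close> a natural number, so that \<open>n = 0\<close>
  (discrete, hence finite, compact groups) is included.  Smoothness is only ever applied to
  functions on open subsets \<open>D\<close> of that space; the values of \<open>f\<close> outside \<open>D\<close> are irrelevant then.
\<close>

definition partial_deriv :: "nat \<Rightarrow> ((nat \<Rightarrow> real) \<Rightarrow> real) \<Rightarrow> (nat \<Rightarrow> real) \<Rightarrow> real" where
  "partial_deriv i f x = deriv (\<lambda>t. f (x(i := t))) (x i)"

primrec Ck_on :: "nat \<Rightarrow> nat \<Rightarrow> (nat \<Rightarrow> real) set \<Rightarrow> ((nat \<Rightarrow> real) \<Rightarrow> real) \<Rightarrow> bool" where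
  "Ck_on n 0 D f \<longleftrightarrow> continuous_map (subtopology (Euclidean_space n) D) euclideanreal f"
| "Ck_on n (Suc k) D f \<longleftrightarrow>
     continuous_map (subtopology (Euclidean_space n) D) euclideanreal f \<and>
     (\<forall>i<n. (\<forall>x\<in>D. (\<lambda>t. f (x(i := t))) differentiable (at (x i))) \<and>
            Ck_on n k D (partial_deriv i f))"

definition smooth_map_on ::
  "nat \<Rightarrow> nat \<Rightarrow> (nat \<Rightarrow> real) set \<Rightarrow> ((nat \<Rightarrow> real) \<Rightarrow> (nat \<Rightarrow> real)) \<Rightarrow> bool" where
  "smooth_map_on n p D F \<longleftrightarrow> (\<forall>j<p. \<forall>k. Ck_on n k D (\<lambda>x. F x j))"

definition smooth_atlas ::
  "nat \<Rightarrow> 'g topology \<Rightarrow> ('g set \<times> ('g \<Rightarrow> nat \<Rightarrow> real)) set \<Rightarrow> bool" where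
  "smooth_atlas n TG \<A> \<longleftrightarrow>
     (\<Union>(P, \<phi>)\<in>\<A>. P) = topspace TG \<and>
     (\<forall>(P, \<phi>)\<in>\<A>. openin TG P \<and> openin (Euclidean_space n) (\<phi> ` P) \<and>
        homeomorphic_map (subtopology TG P) (subtopology (Euclidean_space n) (\<phi> ` P)) \<phi>) \<and>
     (\<forall>(P, \<phi>)\<in>\<A>. \<forall>(Q, \<psi>)\<in>\<A>.
        smooth_map_on n n (\<phi> ` (P \<inter> Q)) (\<lambda>x. \<psi> (inv_into P \<phi> x)))"

text \<open>The two halves of a point of the \<open>2n\<close>-dimensional space, used as product chart coordinates.\<close>

definition left_half :: "nat \<Rightarrow> (nat \<Rightarrow> real) \<Rightarrow> nat \<Rightarrow> real" where
  "left_half n z = (\<lambda>i. if i < n then z i else 0)"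

definition right_half :: "nat \<Rightarrow> (nat \<Rightarrow> real) \<Rightarrow> nat \<Rightarrow> real" where
  "right_half n z = (\<lambda>i. if i < n then z (n + i) else 0)"

definition smooth_mult ::
  "('g, 'b) monoid_scheme \<Rightarrow> nat \<Rightarrow> ('g set \<times> ('g \<Rightarrow> nat \<Rightarrow> real)) set \<Rightarrow> bool" where
  "smooth_mult G n \<A> \<longleftrightarrow>
     (\<forall>(P, \<phi>)\<in>\<A>. \<forall>(Q, \<psi>)\<in>\<A>. \<forall>(R, \<theta>)\<in>\<A>.
        let m = (\<lambda>z. inv_into P \<phi> (left_half n z) \<otimes>\<^bsub>G\<^esub> inv_into Q \<psi> (right_half n z)) in
        smooth_map_on (2 * n) n
          {z \<in> topspace (Euclidean_space (2 * n)).
             left_half n z \<in> \<phi> ` P \<and> right_half n z \<in> \<psi> ` Q \<and> m z \<in> R}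
          (\<lambda>z. \<theta> (m z)))"

definition smooth_inv ::
  "('g, 'b) monoid_scheme \<Rightarrow> nat \<Rightarrow> ('g set \<times> ('g \<Rightarrow> nat \<Rightarrow> real)) set \<Rightarrow> bool" where
  "smooth_inv G n \<A> \<longleftrightarrow>
     (\<forall>(P, \<phi>)\<in>\<A>. \<forall>(Q, \<psi>)\<in>\<A>.
        smooth_map_on n n (\<phi> ` {g \<in> P. inv\<^bsub>G\<^esub> g \<in> Q}) (\<lambda>x. \<psi> (inv\<^bsub>G\<^esub> (inv_into P \<phi> x))))"

definition compact_Lie_group :: "('g, 'b) monoid_scheme \<Rightarrow> 'g topology \<Rightarrow> bool" where
  "compact_Lie_group G TG \<longleftrightarrow>
     Group.group G \<and> topspace TG = carrier G \<and>
     compact_space TG \<and> Hausdorff_space TG \<and> second_countable TG \<and>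
     continuous_map (prod_topology TG TG) TG (\<lambda>(g, h). g \<otimes>\<^bsub>G\<^esub> h) \<and>
     continuous_map TG TG (\<lambda>g. inv\<^bsub>G\<^esub> g) \<and>
     (\<exists>n \<A>. smooth_atlas n TG \<A> \<and> smooth_mult G n \<A> \<and> smooth_inv G n \<A>)"


section \<open>Operators on finite-dimensional Hilbert spaces\<close>

text \<open>
  The Hilbert space of dimension \<open>N\<close> is \<^term>\<open>carrier_vec N :: complex vec set\<close> with the inner
  product \<open>(\<bullet>c)\<close>; operators are complex matrices.
\<close>

definition unitary_mat :: "nat \<Rightarrow> complex mat \<Rightarrow> bool" where
  "unitary_mat n A \<longleftrightarrow>
     A \<in> carrier_mat n n \<and> mat_adjoint A * A = 1\<^sub>m n \<and> A * mat_adjoint A = 1\<^sub>m n"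

text \<open>In the order on \<^typ>\<open>complex\<close>, \<open>0 \<le> z\<close> says that \<open>z\<close> is real and nonnegative.\<close>

definition positive_mat :: "nat \<Rightarrow> complex mat \<Rightarrow> bool" where
  "positive_mat n A \<longleftrightarrow> A \<in> carrier_mat n n \<and> (\<forall>v\<in>carrier_vec n. 0 \<le> (A *\<^sub>v v) \<bullet>c v)"

definition mat_trace :: "complex mat \<Rightarrow> complex" where
  "mat_trace A = (\<Sum>i<dim_row A. A $$ (i, i))"

abbreviation is_subspace :: "nat \<Rightarrow> complex vec set \<Rightarrow> bool" where
  "is_subspace N V \<equiv> VectorSpace.subspace class_ring V (module_vec TYPE(complex) N)"

abbreviation subspace_dim :: "nat \<Rightarrow> complex vec set \<Rightarrow> nat" where
  "subspace_dim N V \<equiv>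
     vectorspace.dim class_ring ((module_vec TYPE(complex) N)\<lparr>carrier := V\<rparr>)"

abbreviation mat_range :: "complex mat \<Rightarrow> complex vec set" where
  "mat_range A \<equiv> (\<lambda>v. A *\<^sub>v v) ` carrier_vec (dim_col A)"

definition orthogonal_decomposition :: "nat \<Rightarrow> 'j set \<Rightarrow> ('j \<Rightarrow> complex vec set) \<Rightarrow> bool" where
  "orthogonal_decomposition N J F \<longleftrightarrow>
     (\<forall>j\<in>J. is_subspace N (F j)) \<and>
     (\<forall>j\<in>J. \<forall>j'\<in>J. j \<noteq> j' \<longrightarrow> (\<forall>v\<in>F j. \<forall>w\<in>F j'. v \<bullet>c w = 0)) \<and>
     LinearCombinations.module.span class_ring (module_vec TYPE(complex) N) (\<Union>j\<in>J. F j)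
       = carrier_vec N"

definition partial_isometry ::
  "nat \<Rightarrow> complex mat \<Rightarrow> complex vec set \<Rightarrow> complex vec set \<Rightarrow> bool" where
  "partial_isometry N A V W \<longleftrightarrow>
     A \<in> carrier_mat N N \<and>
     (\<forall>v\<in>V. (A *\<^sub>v v) \<bullet>c (A *\<^sub>v v) = v \<bullet>c v) \<and>
     (\<forall>v\<in>carrier_vec N. (\<forall>w\<in>V. v \<bullet>c w = 0) \<longrightarrow> A *\<^sub>v v = 0\<^sub>v N) \<and>
     (\<lambda>v. A *\<^sub>v v) ` V = W"

definition orthogonal_projector :: "nat \<Rightarrow> complex mat \<Rightarrow> complex vec set \<Rightarrow> bool" where
  "orthogonal_projector N P V \<longleftrightarrow>
     P \<in> carrier_mat N N \<and>
     (\<forall>v\<in>V. P *\<^sub>v v = v) \<and>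
     (\<forall>v\<in>carrier_vec N. (\<forall>w\<in>V. v \<bullet>c w = 0) \<longrightarrow> P *\<^sub>v v = 0\<^sub>v N)"

text \<open>
  The space of dimension \<open>d * m\<close> is the tensor product of those of dimensions \<open>d\<close> and \<open>m\<close>, the
  basis vector with index \<open>a * m + b\<close> being the tensor product of the basis vectors \<open>a\<close> and \<open>b\<close>.
\<close>

definition tensor_mat :: "complex mat \<Rightarrow> complex mat \<Rightarrow> complex mat" where
  "tensor_mat A B = mat (dim_row A * dim_row B) (dim_col A * dim_col B)
     (\<lambda>(i, j). A $$ (i div dim_row B, j div dim_col B) * B $$ (i mod dim_row B, j mod dim_col B))"

definition partial_trace :: "nat \<Rightarrow> nat \<Rightarrow> complex mat \<Rightarrow> complex mat" where
  "partial_trace d m M = mat m m (\<lambda>(b, b'). \<Sum>a<d. M $$ (a * m + b, a * m + b'))"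


section \<open>Projective representations and their irreducible constituents\<close>

definition projective_unitary_rep ::
  "('g, 'b) monoid_scheme \<Rightarrow> 'g topology \<Rightarrow> nat \<Rightarrow> ('g \<Rightarrow> complex mat) \<Rightarrow> bool" where
  "projective_unitary_rep G TG N U \<longleftrightarrow>
     (\<forall>g\<in>carrier G. unitary_mat N (U g)) \<and>
     (\<exists>c :: 'g \<Rightarrow> 'g \<Rightarrow> complex. \<forall>g\<in>carrier G. \<forall>h\<in>carrier G.
        cmod (c g h) = 1 \<and> U g * U h = c g h \<cdot>\<^sub>m U (g \<otimes>\<^bsub>G\<^esub> h)) \<and>
     (\<forall>X\<in>carrier_mat N N. \<forall>i<N. \<forall>j<N.
        continuous_map TG euclidean (\<lambda>g. (U g * X * mat_adjoint (U g)) $$ (i, j)))"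

text \<open>
  In what follows \<open>K\<close> is the whole group or a subgroup, and \<open>{U h | h \<in> K}\<close> is the (restricted)
  representation.  Its irreducible subrepresentations are given by subspaces of the Hilbert space,
  and an equivalence class of irreps occurring in it is an equivalence class of such subspaces.
\<close>

definition invariant_subspace :: "nat \<Rightarrow> 'g set \<Rightarrow> ('g \<Rightarrow> complex mat) \<Rightarrow> complex vec set \<Rightarrow> bool" where
  "invariant_subspace N K U V \<longleftrightarrow> is_subspace N V \<and> (\<forall>h\<in>K. \<forall>v\<in>V. U h *\<^sub>v v \<in> V)"

definition irreps :: "nat \<Rightarrow> 'g set \<Rightarrow> ('g \<Rightarrow> complex mat) \<Rightarrow> complex vec set set" where
  "irreps N K U =
     {V. invariant_subspace N K U V \<and> V \<noteq> {0\<^sub>v N} \<and>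
         (\<forall>W. invariant_subspace N K U W \<and> W \<subseteq> V \<longrightarrow> W = {0\<^sub>v N} \<or> W = V)}"

text \<open>Every linear map between subspaces extends to a matrix on the whole space, so quantifying
  over matrices \<open>M\<close> covers all intertwiners.\<close>

definition irrep_equiv ::
  "nat \<Rightarrow> 'g set \<Rightarrow> ('g \<Rightarrow> complex mat) \<Rightarrow> (complex vec set \<times> complex vec set) set" where
  "irrep_equiv N K U =
     {(V, W). V \<in> irreps N K U \<and> W \<in> irreps N K U \<and>
        (\<exists>M\<in>carrier_mat N N. bij_betw (\<lambda>v. M *\<^sub>v v) V W \<and>
           (\<forall>h\<in>K. \<forall>v\<in>V. M *\<^sub>v (U h *\<^sub>v v) = U h *\<^sub>v (M *\<^sub>v v)))}"

type_synonym irrep_class = "complex vec set set"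

definition irrep_classes :: "nat \<Rightarrow> 'g set \<Rightarrow> ('g \<Rightarrow> complex mat) \<Rightarrow> irrep_class set" where
  "irrep_classes N K U = irreps N K U // irrep_equiv N K U"

text \<open>The common dimension of the members of a class.\<close>

definition class_dim :: "nat \<Rightarrow> irrep_class \<Rightarrow> nat" where
  "class_dim N \<mu> = (THE d. \<forall>V\<in>\<mu>. subspace_dim N V = d)"

definition irreducible_decomposition ::
  "nat \<Rightarrow> 'g set \<Rightarrow> ('g \<Rightarrow> complex mat) \<Rightarrow> (irrep_class \<Rightarrow> nat) \<Rightarrow>
   (irrep_class \<Rightarrow> nat \<Rightarrow> complex vec set) \<Rightarrow> bool" where
  "irreducible_decomposition N K U m H \<longleftrightarrow>
     (\<forall>\<mu>\<in>irrep_classes N K U. 0 < m \<mu> \<and> (\<forall>k\<in>{1..m \<mu>}. H \<mu> k \<in> \<mu>)) \<and>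
     orthogonal_decomposition N (SIGMA \<mu>:irrep_classes N K U. {1..m \<mu>}) (\<lambda>(\<mu>, k). H \<mu> k)"

definition invariant_isomorphisms ::
  "nat \<Rightarrow> 'g set \<Rightarrow> ('g \<Rightarrow> complex mat) \<Rightarrow> (irrep_class \<Rightarrow> nat) \<Rightarrow>
   (irrep_class \<Rightarrow> nat \<Rightarrow> complex vec set) \<Rightarrow> (irrep_class \<Rightarrow> nat \<Rightarrow> nat \<Rightarrow> complex mat) \<Rightarrow> bool" where
  "invariant_isomorphisms N K U m H T \<longleftrightarrow>
     (\<forall>\<mu>\<in>irrep_classes N K U.
        (\<forall>k\<in>{1..m \<mu>}. \<forall>l\<in>{1..m \<mu>}.
           partial_isometry N (T \<mu> k l) (H \<mu> l) (H \<mu> k) \<and>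
           (\<forall>g\<in>K. T \<mu> k l * U g = U g * T \<mu> k l)) \<and>
        (\<forall>k\<in>{1..m \<mu>}. orthogonal_projector N (T \<mu> k k) (H \<mu> k)) \<and>
        (\<forall>k\<in>{1..m \<mu>}. \<forall>l\<in>{1..m \<mu>}. \<forall>n\<in>{1..m \<mu>}. T \<mu> k l * T \<mu> l n = T \<mu> k n))"

text \<open>\<open>R\<close> is a matrix form, in an orthonormal basis, of the irrep carried by a member of the class
  \<open>\<nu>\<close>.\<close>

definition matrix_irrep_of_class ::
  "nat \<Rightarrow> 'g set \<Rightarrow> ('g \<Rightarrow> complex mat) \<Rightarrow> irrep_class \<Rightarrow> ('g \<Rightarrow> complex mat) \<Rightarrow> bool" where
  "matrix_irrep_of_class N K U \<nu> R \<longleftrightarrow>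
     (\<forall>h\<in>K. R h \<in> carrier_mat (class_dim N \<nu>) (class_dim N \<nu>)) \<and>
     (\<exists>J\<in>carrier_mat N (class_dim N \<nu>).
        mat_adjoint J * J = 1\<^sub>m (class_dim N \<nu>) \<and> mat_range J \<in> \<nu> \<and>
        (\<forall>h\<in>K. U h * J = J * R h))"

text \<open>
  The isometry \<open>W \<nu>\<close> identifies the tensor product of the irrep space of class \<open>\<nu>\<close> and the
  multiplicity space of dimension \<open>m \<nu>\<close> with a subspace of the Hilbert space; on it \<open>U h\<close> acts as
  the tensor product of \<open>R \<nu> h\<close> and the identity.
\<close>

definition tensor_decomposition ::
  "nat \<Rightarrow> 'g set \<Rightarrow> ('g \<Rightarrow> complex mat) \<Rightarrow> (irrep_class \<Rightarrow> nat) \<Rightarrow>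
   (irrep_class \<Rightarrow> 'g \<Rightarrow> complex mat) \<Rightarrow> (irrep_class \<Rightarrow> complex mat) \<Rightarrow> bool" where
  "tensor_decomposition N K U m R W \<longleftrightarrow>
     (\<forall>\<nu>\<in>irrep_classes N K U.
        0 < m \<nu> \<and> matrix_irrep_of_class N K U \<nu> (R \<nu>) \<and>
        W \<nu> \<in> carrier_mat N (class_dim N \<nu> * m \<nu>) \<and>
        mat_adjoint (W \<nu>) * W \<nu> = 1\<^sub>m (class_dim N \<nu> * m \<nu>) \<and>
        (\<forall>h\<in>K. U h * W \<nu> = W \<nu> * tensor_mat (R \<nu> h) (1\<^sub>m (m \<nu>)))) \<and>
     orthogonal_decomposition N (irrep_classes N K U) (\<lambda>\<nu>. mat_range (W \<nu>))"


section \<open>The convex set of covariant POVM seeds\<close>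

abbreviation Omega ::
  "nat \<Rightarrow> ('g \<Rightarrow> complex mat) \<Rightarrow> 'i set \<Rightarrow> ('i \<Rightarrow> 'g set) \<Rightarrow> ('i \<times> irrep_class) set" where
  "Omega N U I K \<equiv> (SIGMA i:I. irrep_classes N (K i) U)"

definition isotypic_projector :: "complex mat \<Rightarrow> complex mat" where
  "isotypic_projector W = W * mat_adjoint W"

text \<open>The compression of \<open>T\<close> by the isotypic projector, transported to the tensor product space
  by \<open>W\<close> and traced over the irrep space.\<close>

definition S_block ::
  "nat \<Rightarrow> ('i \<Rightarrow> irrep_class \<Rightarrow> nat) \<Rightarrow> ('i \<Rightarrow> irrep_class \<Rightarrow> complex mat) \<Rightarrow>
   complex mat \<Rightarrow> 'i \<times> irrep_class \<Rightarrow> complex mat" where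
  "S_block N mI W T = (\<lambda>(i, \<nu>).
     partial_trace (class_dim N \<nu>) (mI i \<nu>)
       (mat_adjoint (W i \<nu>) *
        (isotypic_projector (W i \<nu>) * T * isotypic_projector (W i \<nu>)) * W i \<nu>))"

text \<open>
  A block operator is the family of its blocks, indexed by \<open>\<Omega>\<close> and undefined elsewhere.
\<close>

definition block_operators ::
  "('i \<times> irrep_class) set \<Rightarrow> ('i \<Rightarrow> irrep_class \<Rightarrow> nat) \<Rightarrow> ('i \<times> irrep_class \<Rightarrow> complex mat) set" where
  "block_operators \<Omega> mI = (\<Pi>\<^sub>E (i, \<nu>)\<in>\<Omega>. carrier_mat (mI i \<nu>) (mI i \<nu>))"

definition covariant_seeds ::
  "nat \<Rightarrow> 'g set \<Rightarrow> ('g \<Rightarrow> complex mat) \<Rightarrow> (irrep_class \<Rightarrow> nat) \<Rightarrow>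
   (irrep_class \<Rightarrow> nat \<Rightarrow> nat \<Rightarrow> complex mat) \<Rightarrow> ('i \<times> irrep_class) set \<Rightarrow>
   ('i \<Rightarrow> irrep_class \<Rightarrow> nat) \<Rightarrow> ('i \<Rightarrow> irrep_class \<Rightarrow> complex mat) \<Rightarrow>
   ('i \<times> irrep_class \<Rightarrow> complex mat) set" where
  "covariant_seeds N K U m T \<Omega> mI W =
     {A \<in> block_operators \<Omega> mI.
        (\<forall>(i, \<nu>)\<in>\<Omega>. positive_mat (mI i \<nu>) (A (i, \<nu>))) \<and>
        (\<forall>\<mu>\<in>irrep_classes N K U. \<forall>k\<in>{1..m \<mu>}. \<forall>l\<in>{1..m \<mu>}.
           (\<Sum>\<omega>\<in>\<Omega>. mat_trace (S_block N mI W (T \<mu> k l) \<omega> * A \<omega>))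
             = (if k = l then of_nat (class_dim N \<mu>) else 0))}"

text \<open>This is \<open>extreme_point_of\<close> of HOL-Analysis, restated because families of \<^typ>\<open>complex mat\<close>
  do not form an instance of \<^class>\<open>real_vector\<close>.\<close>

definition extreme_block_operator ::
  "('i \<times> irrep_class) set \<Rightarrow> ('i \<times> irrep_class \<Rightarrow> complex mat) set \<Rightarrow>
   ('i \<times> irrep_class \<Rightarrow> complex mat) \<Rightarrow> bool" where
  "extreme_block_operator \<Omega> D A \<longleftrightarrow>
     A \<in> D \<and>
     (\<forall>B\<in>D. \<forall>C\<in>D. \<forall>t::real. 0 < t \<and> t < 1 \<and>
        A = (\<lambda>\<omega>\<in>\<Omega>. complex_of_real (1 - t) \<cdot>\<^sub>m B \<omega> + complex_of_real t \<cdot>\<^sub>m C \<omega>) \<longrightarrow> B = C)"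

end

(* Suppose the ranks are too large. Perturbing A by A C A, where C is supported on index pairs of
   independent columns of X, is an injective linear operation on a space of complex dimension
   sum r^2, while the trace constraints are sum m^2 linear equations; so some C <> 0 satisfies
   all of them homogeneously. Since the adjoint of T_kl is T_lk, the constraints are closed under
   adjoints, so C may be taken Hermitian. Then A + s A C A = X* (1 + s X C X* ) X, which stays
   positive for small real s of either sign, so A is a proper midpoint of two points of D. *)

theory Submission
  imports Defs
begin

text \<open>Write X^H for the adjoint of X. The obstacle is positivity: A may be singular, and then
  an arbitrary Hermitian direction can leave the positive cone at once. Directions X^H D X are safe,
  because they vanish wherever the form of A does, but D itself is a poor unknown: what it does off
  the range of X is lost in X^H D X. Putting D = X C X^H moves the unknown to C, and confining C to
  the rows and columns of r independent columns of X leaves exactly r^2 unknowns, all of them plain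
  matrix entries that A C A still determines.

  Equations and unknowns are both counted over the complex numbers, and Hermiticity is imposed
  afterwards: if C solves the system, so do its adjoint and every combination z C + cnj z C^H, and
  some z makes this combination non-zero.

  Two facts that look like part of the data have to be derived. The adjoint relation between T_kl
  and T_lk comes from the partial isometry and composition laws. Finiteness of the sets of classes
  comes from orthogonality of the components; without it the sums and cardinalities compared here
  would collapse to their default value 0.\<close>

unbundle no vec_syntax

section \<open>Homogeneous linear systems\<close>

text \<open>Gaussian elimination, one equation per induction step. The index sets are arbitrary
  finite sets, so that matrix positions spread over several blocks can serve directly as
  unknowns.\<close>

lemma homogeneous_system_nontrivial_solution:
  fixes f :: "'q \<Rightarrow> 'p \<Rightarrow> 'a::field"
  assumes "finite Q" "finite P" "card Q < card P"
  shows "\<exists>c. (\<exists>p\<in>P. c p \<noteq> 0) \<and> (\<forall>q\<in>Q. (\<Sum>p\<in>P. c p * f q p) = 0)"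
  using assms
proof (induction Q arbitrary: P f rule: finite_induct)
  case empty
  then have "P \<noteq> {}" by auto
  then show ?case by (intro exI[of _ "\<lambda>_. 1"]) auto
next
  case (insert q Q)
  show ?case
  proof (cases "\<forall>p\<in>P. f q p = 0")
    case True
    have "card Q < card P" using insert by simp
    from insert.IH[OF insert.prems(1) this, of f] True show ?thesis by auto
  next
    case False
    then obtain p0 where p0: "p0 \<in> P" "f q p0 \<noteq> 0" by auto
    let ?P = "P - {p0}"
    have fin: "finite ?P" using insert by simp
    have "card Q < card ?P" using insert p0 by simp
    \<comment> \<open>Solving equation \<open>q\<close> for the unknown \<open>p0\<close> and
      substituting into equation \<open>r\<close> yields these coefficients; \<open>- s\<close>
      below is the value that equation \<open>q\<close> then forces on \<open>p0\<close>.\<close>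
    from insert.IH[OF fin this, of "\<lambda>r p. f r p - f r p0 * f q p / f q p0"]
    obtain c where c: "\<exists>p\<in>?P. c p \<noteq> 0"
      "\<And>r. r \<in> Q \<Longrightarrow> (\<Sum>p\<in>?P. c p * (f r p - f r p0 * f q p / f q p0)) = 0" by auto
    define s where "s = (\<Sum>p\<in>?P. c p * f q p) / f q p0"
    define d where "d = c(p0 := - s)"
    have sum_d: "(\<Sum>p\<in>P. d p * f r p) = (\<Sum>p\<in>?P. c p * f r p) - s * f r p0" for r
    proof -
      have "(\<Sum>p\<in>P. d p * f r p) = d p0 * f r p0 + (\<Sum>p\<in>?P. d p * f r p)"
        using p0 insert.prems by (simp add: sum.remove)
      moreover have "(\<Sum>p\<in>?P. d p * f r p) = (\<Sum>p\<in>?P. c p * f r p)"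
        by (rule sum.cong) (auto simp: d_def)
      ultimately show ?thesis by (simp add: d_def)
    qed
    have "(\<Sum>p\<in>P. d p * f r p) = 0" if "r \<in> Q" for r
    proof -
      have "(\<Sum>p\<in>?P. c p * (f r p - f r p0 * f q p / f q p0))
          = (\<Sum>p\<in>?P. c p * f r p) - (\<Sum>p\<in>?P. c p * f q p) * (f r p0 / f q p0)"
        unfolding sum_distrib_right sum_subtractf[symmetric]
        by (rule sum.cong) (auto simp: algebra_simps)
      then show ?thesis using c(2)[OF that] unfolding sum_d s_def by simp
    qed
    moreover have "(\<Sum>p\<in>P. d p * f q p) = 0" unfolding sum_d s_def using p0 by simp
    moreover have "\<exists>p\<in>P. d p \<noteq> 0" using c(1) by (auto simp: d_def)
    ultimately show ?thesis by blast
  qed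
qed


section \<open>Adjoints and quadratic forms\<close>

lemma dim_adjoint [simp]:
  "dim_row (mat_adjoint A) = dim_col A" "dim_col (mat_adjoint A) = dim_row A"
  by (simp_all add: mat_adjoint_def)

lemma adjoint_carrier [intro, simp]:
  "A \<in> carrier_mat n k \<Longrightarrow> mat_adjoint A \<in> carrier_mat k n"
  unfolding carrier_mat_def by simp

lemma index_adjoint [simp]:
  fixes A :: "complex mat"
  shows "i < dim_col A \<Longrightarrow> j < dim_row A \<Longrightarrow> mat_adjoint A $$ (i, j) = cnj (A $$ (j, i))"
  by (simp add: mat_adjoint_def mat_of_rows_def)

lemma adjoint_adjoint [simp]: "mat_adjoint (mat_adjoint A) = (A :: complex mat)"
  by (rule eq_matI) auto

lemma adjoint_mult:
  fixes A B :: "complex mat"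
  assumes "A \<in> carrier_mat n k" "B \<in> carrier_mat k l"
  shows "mat_adjoint (A * B) = mat_adjoint B * mat_adjoint A"
  using assms by (intro eq_matI) (auto simp: scalar_prod_def mult.commute intro!: sum.cong)

lemma adjoint_zero [simp]: "mat_adjoint (0\<^sub>m n k :: complex mat) = 0\<^sub>m k n"
  by (intro eq_matI) auto

lemma inner_mult_mat_vec:
  fixes A :: "complex mat"
  assumes "A \<in> carrier_mat n k" "v \<in> carrier_vec k" "w \<in> carrier_vec n"
  shows "(A *\<^sub>v v) \<bullet>c w = (\<Sum>i<n. \<Sum>j<k. A $$ (i, j) * v $ j * cnj (w $ i))"
  using assms by (auto simp: scalar_prod_def sum_distrib_right atLeast0LessThan intro!: sum.cong)

lemma inner_adjoint:
  fixes A :: "complex mat"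
  assumes "A \<in> carrier_mat n k" "v \<in> carrier_vec k" "w \<in> carrier_vec n"
  shows "(A *\<^sub>v v) \<bullet>c w = v \<bullet>c (mat_adjoint A *\<^sub>v w)"
proof -
  have "v \<bullet>c (mat_adjoint A *\<^sub>v w) = (\<Sum>j<k. \<Sum>i<n. A $$ (i, j) * v $ j * cnj (w $ i))"
    using assms by (auto simp: scalar_prod_def sum_distrib_left atLeast0LessThan mult_ac intro!: sum.cong)
  also have "\<dots> = (\<Sum>i<n. \<Sum>j<k. A $$ (i, j) * v $ j * cnj (w $ i))" by (rule sum.swap)
  finally show ?thesis using inner_mult_mat_vec[OF assms] by simp
qed

lemma inner_self:
  fixes v :: "complex vec"
  assumes "v \<in> carrier_vec n"
  shows "v \<bullet>c v = complex_of_real (\<Sum>i<n. (cmod (v $ i))\<^sup>2)"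
  using assms by (auto simp: scalar_prod_def atLeast0LessThan complex_norm_square[symmetric]
      simp del: of_real_power intro!: sum.cong)

lemma inner_commute:
  fixes v w :: "complex vec"
  assumes "v \<in> carrier_vec n" "w \<in> carrier_vec n"
  shows "w \<bullet>c v = cnj (v \<bullet>c w)"
  using assms by (auto simp: scalar_prod_def mult.commute intro!: sum.cong)

lemma adjoint_mult_self_eq_0:
  fixes A :: "complex mat"
  assumes A: "A \<in> carrier_mat n k" and 0: "mat_adjoint A * A = 0\<^sub>m k k"
  shows "A = 0\<^sub>m n k"
proof (rule eq_matI)
  fix i j assume "i < dim_row (0\<^sub>m n k :: complex mat)" "j < dim_col (0\<^sub>m n k :: complex mat)"
  then have ij: "i < n" "j < k" by auto
  have "(mat_adjoint A * A) $$ (j, j) = complex_of_real (\<Sum>i<n. (cmod (A $$ (i, j)))\<^sup>2)"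
    using A ij by (auto simp: scalar_prod_def atLeast0LessThan complex_norm_square mult.commute
        simp del: of_real_power intro!: sum.cong)
  then have "(\<Sum>i<n. (cmod (A $$ (i, j)))\<^sup>2) = 0"
    using 0 ij by (metis index_zero_mat(1) of_real_eq_0_iff)
  then show "A $$ (i, j) = 0\<^sub>m n k $$ (i, j)"
    using ij by (subst (asm) sum_nonneg_eq_0_iff) auto
qed (use A in auto)

text \<open>A and A^H A have the same kernel: multiplying the hypothesis by M^H on the left turns it
  into (A M)^H (A M) = 0, and the diagonal of this product holds the squared column norms of A
  M.\<close>

lemma adjoint_mult_cancel:
  fixes A M :: "complex mat"
  assumes A: "A \<in> carrier_mat n k" and M: "M \<in> carrier_mat k l"
    and 0: "mat_adjoint A * A * M = 0\<^sub>m k l"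
  shows "A * M = 0\<^sub>m n l"
proof (rule adjoint_mult_self_eq_0)
  have "mat_adjoint (A * M) * (A * M) = mat_adjoint M * (mat_adjoint A * A * M)"
    using A M by (simp add: adjoint_mult[OF A M] assoc_mult_mat[of _ l k _ n _ l]
        assoc_mult_mat[of _ k n A k M l])
  then show "mat_adjoint (A * M) * (A * M) = 0\<^sub>m l l" using M unfolding 0 by simp
qed (use A M in auto)

section \<open>Quadratic forms and positivity under small perturbations\<close>

lemma mult_mat_unit_vec:
  fixes A :: "complex mat"
  assumes "A \<in> carrier_mat n k" "j < k"
  shows "A *\<^sub>v unit_vec k j = col A j"
  using assms by (intro eq_vecI) (auto simp: scalar_prod_right_unit)

lemma smult_mat_mult_vec:
  fixes A :: "complex mat"
  assumes "A \<in> carrier_mat n k" "v \<in> carrier_vec k"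
  shows "(c \<cdot>\<^sub>m A) *\<^sub>v v = c \<cdot>\<^sub>v (A *\<^sub>v v)"
  using assms by (intro eq_vecI) auto

text \<open>Complex polarisation: testing on e_i + c e_j, the choice c = 1 kills D_ij + D_ji and the
  choice c = \<open>\<i>\<close> kills D_ij - D_ji.\<close>

lemma quadratic_form_eq_0:
  fixes D :: "complex mat"
  assumes D: "D \<in> carrier_mat n n" and 0: "\<And>v. v \<in> carrier_vec n \<Longrightarrow> (D *\<^sub>v v) \<bullet>c v = 0"
  shows "D = 0\<^sub>m n n"
proof (rule eq_matI)
  fix i j assume "i < dim_row (0\<^sub>m n n :: complex mat)" "j < dim_col (0\<^sub>m n n :: complex mat)"
  then have ij: "i < n" "j < n" by auto
  have unit: "(D *\<^sub>v unit_vec n b) \<bullet>c unit_vec n a = D $$ (a, b)" if "a < n" "b < n" for a b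
  proof -
    have "conjugate (unit_vec n a) = (unit_vec n a :: complex vec)"
      by (intro eq_vecI) (auto simp: unit_vec_def)
    then show ?thesis using that D by (simp add: mult_mat_unit_vec[OF D])
  qed
  have *: "cnj c * D $$ (j, i) + c * D $$ (i, j) = 0" for c
  proof -
    let ?i = "unit_vec n i :: complex vec" and ?j = "unit_vec n j :: complex vec"
    have "(D *\<^sub>v (?i + c \<cdot>\<^sub>v ?j)) \<bullet>c (?i + c \<cdot>\<^sub>v ?j)
       = (D *\<^sub>v ?i) \<bullet>c ?i + cnj c * ((D *\<^sub>v ?i) \<bullet>c ?j) + c * ((D *\<^sub>v ?j) \<bullet>c ?i)
         + c * cnj c * ((D *\<^sub>v ?j) \<bullet>c ?j)"
      using D by (simp add: mult_add_distrib_mat_vec[of _ n n] mult_mat_vec[of _ n n]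
          conjugate_add_vec[of _ n] conjugate_smult_vec add_scalar_prod_distrib[of _ n]
          scalar_prod_add_distrib[of _ n] algebra_simps)
    then show ?thesis using 0[of ?i] 0[of ?j] 0[of "?i + c \<cdot>\<^sub>v ?j"] ij by (simp add: unit)
  qed
  have "D $$ (j, i) + D $$ (i, j) = 0" using *[of 1] by simp
  moreover have "D $$ (i, j) = D $$ (j, i)" using *[of \<i>] by simp
  ultimately have "2 * D $$ (i, j) = 0" by simp
  then show "D $$ (i, j) = 0\<^sub>m n n $$ (i, j)" using ij by simp
qed (use D in auto)

lemma hermitian_form_bound:
  fixes D :: "complex mat"
  assumes D: "D \<in> carrier_mat n n" and herm: "mat_adjoint D = D"
  shows "\<exists>c\<ge>0. \<forall>w\<in>carrier_vec n.
    Im ((D *\<^sub>v w) \<bullet>c w) = 0 \<and> \<bar>Re ((D *\<^sub>v w) \<bullet>c w)\<bar> \<le> c * Re (w \<bullet>c w)"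
proof (intro exI conjI ballI)
  \<comment> \<open>The sum of the moduli of all entries is a crude substitute for the operator
    norm. Each product of two coordinate moduli of \<open>w\<close> is at most the squared norm of
    \<open>w\<close>, and any finite constant will do later.\<close>
  let ?c = "\<Sum>i<n. \<Sum>j<n. cmod (D $$ (i, j))"
  show "0 \<le> ?c" by (intro sum_nonneg) auto
  fix w :: "complex vec" assume w: "w \<in> carrier_vec n"
  have "(D *\<^sub>v w) \<bullet>c w = cnj ((D *\<^sub>v w) \<bullet>c w)"
    using inner_adjoint[OF D w w] inner_commute[of "D *\<^sub>v w" n w] D w herm by simp
  then have "Im ((D *\<^sub>v w) \<bullet>c w) = 0" by (metis complex_cnj_cancel_iff cnj.simps(2) equal_neg_zero)
  moreover have "cmod ((D *\<^sub>v w) \<bullet>c w) \<le> ?c * Re (w \<bullet>c w)"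
  proof -
    let ?s = "\<Sum>i<n. (cmod (w $ i))\<^sup>2"
    have le: "cmod (w $ j) * cmod (w $ i) \<le> ?s" if "i < n" "j < n" for i j
    proof -
      have "(cmod (w $ k))\<^sup>2 \<le> ?s" if "k < n" for k
        using that by (intro member_le_sum) auto
      then have "(cmod (w $ i))\<^sup>2 \<le> ?s" "(cmod (w $ j))\<^sup>2 \<le> ?s" using that by auto
      moreover have "2 * (cmod (w $ j) * cmod (w $ i)) \<le> (cmod (w $ j))\<^sup>2 + (cmod (w $ i))\<^sup>2"
        using sum_squares_bound[of "cmod (w $ j)" "cmod (w $ i)"] by simp
      ultimately show ?thesis by linarith
    qed
    have "cmod ((D *\<^sub>v w) \<bullet>c w) \<le> (\<Sum>i<n. \<Sum>j<n. cmod (D $$ (i, j) * w $ j * cnj (w $ i)))"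
      unfolding inner_mult_mat_vec[OF D w w]
      by (intro order.trans[OF norm_sum] sum_mono order.refl)
    also have "\<dots> \<le> (\<Sum>i<n. \<Sum>j<n. cmod (D $$ (i, j)) * ?s)"
      using le by (intro sum_mono) (auto simp: norm_mult mult.assoc intro!: mult_left_mono)
    finally show ?thesis by (simp add: inner_self[OF w] sum_distrib_right)
  qed
  ultimately show "Im ((D *\<^sub>v w) \<bullet>c w) = 0" "\<bar>Re ((D *\<^sub>v w) \<bullet>c w)\<bar> \<le> ?c * Re (w \<bullet>c w)"
    using abs_Re_le_cmod order.trans by blast+
qed

text \<open>With w = X v the form at v is <w, w> + s <D w, w>. The second term is dominated by the
  first, even where X^H X is singular; this is why the perturbation is sandwiched between the same X
  that factors A.\<close>

lemma positive_mat_perturbation: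
  fixes D X :: "complex mat"
  assumes X: "X \<in> carrier_mat n n" and D: "D \<in> carrier_mat n n"
    and bound: "\<And>w. w \<in> carrier_vec n \<Longrightarrow> Im ((D *\<^sub>v w) \<bullet>c w) = 0 \<and> \<bar>Re ((D *\<^sub>v w) \<bullet>c w)\<bar> \<le> c * Re (w \<bullet>c w)"
    and s: "\<bar>s\<bar> * c \<le> 1"
  shows "positive_mat n (mat_adjoint X * X + complex_of_real s \<cdot>\<^sub>m (mat_adjoint X * D * X))"
  unfolding positive_mat_def
proof (intro conjI ballI)
  fix v :: "complex vec" assume v: "v \<in> carrier_vec n"
  let ?w = "X *\<^sub>v v"
  have w: "?w \<in> carrier_vec n" using X v by simp
  have XM: "(mat_adjoint X *\<^sub>v u) \<bullet>c v = u \<bullet>c ?w" if "u \<in> carrier_vec n" for u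
    using inner_adjoint[OF adjoint_carrier[OF X] that v] by simp
  have "((mat_adjoint X * X + complex_of_real s \<cdot>\<^sub>m (mat_adjoint X * D * X)) *\<^sub>v v) \<bullet>c v
     = ?w \<bullet>c ?w + s * ((D *\<^sub>v ?w) \<bullet>c ?w)"
  proof -
    have "(mat_adjoint X * X + complex_of_real s \<cdot>\<^sub>m (mat_adjoint X * D * X)) *\<^sub>v v
        = mat_adjoint X *\<^sub>v ?w + complex_of_real s \<cdot>\<^sub>v (mat_adjoint X *\<^sub>v (D *\<^sub>v ?w))"
    proof -
      have *: "mat_adjoint X * X \<in> carrier_mat n n" "mat_adjoint X * D \<in> carrier_mat n n"
        "mat_adjoint X * D * X \<in> carrier_mat n n" using X D by auto
      show ?thesis
        using add_mult_distrib_mat_vec[OF *(1) smult_carrier_mat[OF *(3)] v]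
          smult_mat_mult_vec[OF *(3) v] assoc_mult_mat_vec[OF *(2) X v]
          assoc_mult_mat_vec[OF adjoint_carrier[OF X] D w] assoc_mult_mat_vec[OF adjoint_carrier[OF X] X v]
        by simp
    qed
    moreover have "mat_adjoint X *\<^sub>v ?w \<in> carrier_vec n" "D *\<^sub>v ?w \<in> carrier_vec n"
      "mat_adjoint X *\<^sub>v (D *\<^sub>v ?w) \<in> carrier_vec n"
      using X D v w by (auto intro!: mult_mat_vec_carrier)
    ultimately show ?thesis using v w XM
      by (simp add: add_scalar_prod_distrib[of _ n] smult_scalar_prod_distrib[of _ n])
  qed
  moreover have "0 \<le> Re (?w \<bullet>c ?w) + s * Re ((D *\<^sub>v ?w) \<bullet>c ?w)"
  proof -
    have nn: "0 \<le> Re (?w \<bullet>c ?w)" unfolding inner_self[OF w] by (simp add: sum_nonneg)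
    have "\<bar>s * Re ((D *\<^sub>v ?w) \<bullet>c ?w)\<bar> \<le> \<bar>s\<bar> * (c * Re (?w \<bullet>c ?w))"
      using bound[OF w] by (simp add: abs_mult mult_left_mono)
    also have "\<dots> \<le> Re (?w \<bullet>c ?w)" using mult_right_mono[OF s nn] by (simp add: mult.assoc)
    finally show ?thesis by linarith
  qed
  moreover have "Im (?w \<bullet>c ?w) = 0" unfolding inner_self[OF w] by simp
  ultimately show "0 \<le> ((mat_adjoint X * X + complex_of_real s \<cdot>\<^sub>m (mat_adjoint X * D * X)) *\<^sub>v v) \<bullet>c v"
    using bound[OF w] by (simp add: less_eq_complex_def)
qed (use X D in auto)


section \<open>Independent columns\<close>

text \<open>Independence of the columns indexed by \<open>J\<close> is stated as injectivity of X on
  vectors supported on \<open>J\<close>, since for such v the product X v is the linear combination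
  of those columns. In this form it can be applied to matrices whose rows vanish outside
  \<open>J\<close>.\<close>

lemma rank_column_index_set:
  fixes X :: "complex mat"
  assumes X: "X \<in> carrier_mat n k"
  obtains J where "J \<subseteq> {..<k}" "card J = vec_space.rank n X"
    "\<And>v. v \<in> carrier_vec k \<Longrightarrow> (\<And>j. j < k \<Longrightarrow> j \<notin> J \<Longrightarrow> v $ j = 0) \<Longrightarrow>
       X *\<^sub>v v = 0\<^sub>v n \<Longrightarrow> v = 0\<^sub>v k"
proof -
  interpret vec_space "TYPE(complex)" n .
  have "lin_indpt {}" by (auto simp: lin_dep_def)
  then obtain S where S: "maximal S (\<lambda>T. T \<subseteq> set (cols X) \<and> lin_indpt T)"
    using maximal_exists_superset[of "set (cols X)" "\<lambda>T. T \<subseteq> set (cols X) \<and> lin_indpt T" "{}"]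
    by auto
  then have sub: "S \<subseteq> set (cols X)" and indep: "lin_indpt S" by (auto simp: maximal_def)
  have finS: "finite S" using sub finite_subset by blast
  have carrS: "S \<subseteq> carrier_vec n" using sub cols_dim X by blast
  have "\<forall>s\<in>S. \<exists>j<k. col X j = s"
    using sub X by (force simp: cols_def)
  \<comment> \<open>\<open>S\<close> is a set of column vectors in which repeated columns coincide;
    \<open>idx\<close> selects one index for each, so that the number of indices is still the
    rank.\<close>
  then obtain idx where idx: "\<And>s. s \<in> S \<Longrightarrow> idx s < k \<and> col X (idx s) = s" by metis
  have inj: "inj_on idx S" using idx by (metis inj_onI)
  show ?thesis
  proof
    show "idx ` S \<subseteq> {..<k}" using idx by auto
    show "card (idx ` S) = rank X" using rank_card_indpt[OF X S] card_image[OF inj] by simp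
    fix v :: "complex vec"
    assume v: "v \<in> carrier_vec k" and supp: "\<And>j. j < k \<Longrightarrow> j \<notin> idx ` S \<Longrightarrow> v $ j = 0"
      and Xv: "X *\<^sub>v v = 0\<^sub>v n"
    have comb: "lincomb (\<lambda>s. v $ idx s) S = 0\<^sub>v n"
    proof (rule eq_vecI)
      fix i assume "i < dim_vec (0\<^sub>v n :: complex vec)"
      then have i: "i < n" by simp
      have "lincomb (\<lambda>s. v $ idx s) S $ i = (\<Sum>s\<in>S. v $ idx s * s $ i)"
        by (rule lincomb_index[OF i carrS])
      also have "\<dots> = (\<Sum>s\<in>S. X $$ (i, idx s) * v $ idx s)"
      proof (rule sum.cong)
        fix s assume "s \<in> S"
        then have "s $ i = X $$ (i, idx s)" using idx[of s] X i by (metis carrier_matD index_col)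
        then show "v $ idx s * s $ i = X $$ (i, idx s) * v $ idx s" by simp
      qed simp
      also have "\<dots> = (\<Sum>j\<in>idx ` S. X $$ (i, j) * v $ j)" by (simp add: sum.reindex[OF inj])
      also have "\<dots> = (\<Sum>j<k. X $$ (i, j) * v $ j)"
        using idx supp by (intro sum.mono_neutral_left) auto
      also have "\<dots> = (X *\<^sub>v v) $ i"
        using X v i by (auto simp: scalar_prod_def atLeast0LessThan intro!: sum.cong)
      finally show "lincomb (\<lambda>s. v $ idx s) S $ i = 0\<^sub>v n $ i" by (simp add: Xv)
    qed (use lincomb_dim[OF finS carrS] in auto)
    show "v = 0\<^sub>v k"
    proof (rule eq_vecI)
      fix j assume "j < dim_vec (0\<^sub>v k :: complex vec)"
      then have j: "j < k" by simp
      show "v $ j = 0\<^sub>v k $ j"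
      proof (rule ccontr)
        assume "v $ j \<noteq> 0\<^sub>v k $ j"
        then have nz: "v $ j \<noteq> 0" using j by simp
        then obtain s where s: "s \<in> S" "j = idx s" using supp j by auto
        have "lin_dep S"
          using lin_dep_crit[OF finS subset_refl _ s(1) _ comb] nz s(2) by auto
        then show False using indep by simp
      qed
    qed (use v in auto)
  qed
qed

lemma mult_mat_eq_0_columns:
  fixes X M :: "complex mat"
  assumes X: "X \<in> carrier_mat n k" and M: "M \<in> carrier_mat k l"
    and inj: "\<And>v. v \<in> carrier_vec k \<Longrightarrow> (\<And>j. j < k \<Longrightarrow> j \<notin> J \<Longrightarrow> v $ j = 0) \<Longrightarrow>
       X *\<^sub>v v = 0\<^sub>v n \<Longrightarrow> v = 0\<^sub>v k"
    and supp: "\<And>i j. i < k \<Longrightarrow> i \<notin> J \<Longrightarrow> j < l \<Longrightarrow> M $$ (i, j) = 0"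
    and 0: "X * M = 0\<^sub>m n l"
  shows "M = 0\<^sub>m k l"
proof (rule eq_matI)
  fix i j assume "i < dim_row (0\<^sub>m k l :: complex mat)" "j < dim_col (0\<^sub>m k l :: complex mat)"
  then have ij: "i < k" "j < l" by auto
  have "X *\<^sub>v col M j = col (X * M) j" using X M ij by (intro eq_vecI) auto
  then have "X *\<^sub>v col M j = 0\<^sub>v n" using 0 ij by simp
  then have "col M j = 0\<^sub>v k" using M ij supp by (intro inj) auto
  then show "M $$ (i, j) = 0\<^sub>m k l $$ (i, j)" using M ij by (metis carrier_matD index_col index_zero_mat(1) index_zero_vec(1))
qed (use M in auto)


section \<open>Traces\<close>

lemma mat_trace_mult:
  assumes "A \<in> carrier_mat n k" "B \<in> carrier_mat k n"
  shows "mat_trace (A * B) = (\<Sum>i<n. \<Sum>j<k. A $$ (i, j) * B $$ (j, i))"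
  using assms by (auto simp: mat_trace_def scalar_prod_def atLeast0LessThan intro!: sum.cong)

lemma mat_trace_commute:
  assumes "A \<in> carrier_mat n k" "B \<in> carrier_mat k n"
  shows "mat_trace (A * B) = mat_trace (B * A)"
  using assms by (simp add: mat_trace_mult[of _ n k] mat_trace_mult[of _ k n])
    (subst sum.swap, simp add: mult.commute)

lemma mat_trace_add:
  "A \<in> carrier_mat n n \<Longrightarrow> B \<in> carrier_mat n n \<Longrightarrow> mat_trace (A + B) = mat_trace A + mat_trace B"
  by (auto simp: mat_trace_def sum.distrib)

lemma mat_trace_smult: "A \<in> carrier_mat n n \<Longrightarrow> mat_trace (c \<cdot>\<^sub>m A) = c * mat_trace A"
  by (auto simp: mat_trace_def sum_distrib_left)

lemma mat_trace_adjoint: "A \<in> carrier_mat n n \<Longrightarrow> mat_trace (mat_adjoint A) = cnj (mat_trace A)"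
  by (auto simp: mat_trace_def)


section \<open>Hermitian perturbations\<close>

lemma compressed_trace_add:
  fixes S A B C :: "complex mat"
  assumes "S \<in> carrier_mat n n" "A \<in> carrier_mat n n" "B \<in> carrier_mat n n" "C \<in> carrier_mat n n"
  shows "mat_trace (S * (A * (z \<cdot>\<^sub>m B + w \<cdot>\<^sub>m C) * A))
     = z * mat_trace (S * (A * B * A)) + w * mat_trace (S * (A * C * A))"
proof -
  have c: "A * B \<in> carrier_mat n n" "A * C \<in> carrier_mat n n" "A * B * A \<in> carrier_mat n n"
    "A * C * A \<in> carrier_mat n n" "S * (A * B * A) \<in> carrier_mat n n"
    "S * (A * C * A) \<in> carrier_mat n n" using assms by auto
  have "S * (A * (z \<cdot>\<^sub>m B + w \<cdot>\<^sub>m C) * A) = z \<cdot>\<^sub>m (S * (A * B * A)) + w \<cdot>\<^sub>m (S * (A * C * A))"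
    using assms c
    by (simp add: mult_add_distrib_mat[of _ n n _ n] add_mult_distrib_mat[of _ n n _ _ n]
        mult_smult_distrib[of _ n n _ n] mult_smult_assoc_mat[of _ n n _ n])
  then show ?thesis using c by (simp add: mat_trace_add[of _ n] mat_trace_smult[of _ n])
qed

text \<open>By cyclicity of the trace, since A is Hermitian. It carries a solution C of the equation
  for the adjoint of S to the solution C^H of the equation for S.\<close>

lemma compressed_trace_adjoint:
  fixes S A C :: "complex mat"
  assumes "S \<in> carrier_mat n n" "A \<in> carrier_mat n n" "C \<in> carrier_mat n n" "mat_adjoint A = A"
  shows "mat_trace (S * (A * mat_adjoint C * A)) = cnj (mat_trace (mat_adjoint S * (A * C * A)))"
proof -
  have c: "A * C * A \<in> carrier_mat n n" "A * C \<in> carrier_mat n n" using assms by auto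
  have "mat_adjoint (mat_adjoint S * (A * C * A)) = A * mat_adjoint C * A * S"
    using assms c
    by (simp add: adjoint_mult[of _ n n _ n] assoc_mult_mat[of _ n n _ n _ n])
  then have "cnj (mat_trace (mat_adjoint S * (A * C * A))) = mat_trace (A * mat_adjoint C * A * S)"
    using mat_trace_adjoint[OF mult_carrier_mat[OF adjoint_carrier[OF assms(1)] c(1)]] by simp
  also have "\<dots> = mat_trace (S * (A * mat_adjoint C * A))"
    using assms by (intro mat_trace_commute[of _ n n]) auto
  finally show ?thesis by simp
qed

text \<open>This is the injectivity behind the count. Cancelling X^H on the left, taking adjoints
  and cancelling again reduces A C A = 0 to X C X^H = 0. The rows of C X^H vanish outside
  \<open>J\<close>, hence C X^H = 0; one more adjoint gives X C = 0, and the same support argument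
  gives C = 0. Hermiticity of C turns each right factor into a left factor.\<close>

lemma compressed_eq_0:
  fixes X C :: "complex mat"
  assumes X: "X \<in> carrier_mat n n" and C: "C \<in> carrier_mat n n" and herm: "mat_adjoint C = C"
    and inj: "\<And>v. v \<in> carrier_vec n \<Longrightarrow> (\<And>j. j < n \<Longrightarrow> j \<notin> J \<Longrightarrow> v $ j = 0) \<Longrightarrow>
       X *\<^sub>v v = 0\<^sub>v n \<Longrightarrow> v = 0\<^sub>v n"
    and supp: "\<And>i j. i < n \<Longrightarrow> i \<notin> J \<Longrightarrow> j < n \<Longrightarrow> C $$ (i, j) = 0"
    and 0: "mat_adjoint X * X * C * (mat_adjoint X * X) = 0\<^sub>m n n"
  shows "C = 0\<^sub>m n n"
proof -
  let ?A = "mat_adjoint X * X"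
  have X': "mat_adjoint X \<in> carrier_mat n n" and A: "?A \<in> carrier_mat n n" using X by auto
  have A': "mat_adjoint ?A = ?A" using adjoint_mult[OF X' X] by simp
  have "?A * (C * ?A) = 0\<^sub>m n n" using 0 assoc_mult_mat[OF A C A] by simp
  then have "X * (C * ?A) = 0\<^sub>m n n" by (intro adjoint_mult_cancel[OF X]) (use C A in auto)
  then have "mat_adjoint (X * (C * ?A)) = 0\<^sub>m n n" by simp
  then have "?A * (C * mat_adjoint X) = 0\<^sub>m n n"
    using X C A X' A' herm
    by (simp add: adjoint_mult[of _ n n _ n] assoc_mult_mat[of _ n n _ n _ n])
  then have "X * (C * mat_adjoint X) = 0\<^sub>m n n"
    by (intro adjoint_mult_cancel[OF X]) (use C X' in auto)
  moreover have "(C * mat_adjoint X) $$ (i, j) = 0" if "i < n" "i \<notin> J" "j < n" for i j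
    using that C X supp by (simp add: scalar_prod_def)
  ultimately have "C * mat_adjoint X = 0\<^sub>m n n"
    using mult_mat_eq_0_columns[OF X mult_carrier_mat[OF C X'], of J] inj by blast
  then have "mat_adjoint (C * mat_adjoint X) = 0\<^sub>m n n" by simp
  then have "X * C = 0\<^sub>m n n" using adjoint_mult[OF C X'] herm by simp
  then show ?thesis using mult_mat_eq_0_columns[OF X C, of J] inj supp by blast
qed

text \<open>Cyclicity moves both factors A onto S, giving the trace of C (A S A). This displays a
  constraint as a linear equation in the free entries of C, with the entries of A S A as
  coefficients.\<close>

lemma compressed_trace_entries:
  fixes S A C :: "complex mat"
  assumes S: "S \<in> carrier_mat n n" and A: "A \<in> carrier_mat n n" and J: "J \<subseteq> {..<n}"
  shows "mat_trace (S * (A * mat n n (\<lambda>(a, b). if a \<in> J \<and> b \<in> J then c a b else 0) * A))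
     = (\<Sum>(a, b)\<in>J \<times> J. c a b * (A * S * A) $$ (b, a))"
proof -
  let ?C = "mat n n (\<lambda>(a, b). if a \<in> J \<and> b \<in> J then c a b else 0)"
  have C: "?C \<in> carrier_mat n n" by simp
  have c: "S * A * ?C \<in> carrier_mat n n" "A * S \<in> carrier_mat n n" "A * S * A \<in> carrier_mat n n"
    using S A C by auto
  have "S * (A * ?C * A) = (S * A * ?C) * A" "A * (S * A * ?C) = (A * S * A) * ?C"
    using S A C c by (simp_all add: assoc_mult_mat[of _ n n _ n _ n])
  then have "mat_trace (S * (A * ?C * A)) = mat_trace (?C * (A * S * A))"
    using mat_trace_commute[OF c(1) A] mat_trace_commute[OF c(3) C] by simp
  also have "\<dots> = (\<Sum>a<n. \<Sum>b<n. ?C $$ (a, b) * (A * S * A) $$ (b, a))"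
    by (rule mat_trace_mult[OF C c(3)])
  also have "\<dots> = (\<Sum>p\<in>{..<n} \<times> {..<n}. ?C $$ p * (A * S * A) $$ (snd p, fst p))"
    unfolding sum.cartesian_product by (rule sum.cong) auto
  also have "\<dots> = (\<Sum>p\<in>J \<times> J. ?C $$ p * (A * S * A) $$ (snd p, fst p))"
    using J by (intro sum.mono_neutral_right) (auto split: if_splits)
  also have "\<dots> = (\<Sum>(a, b)\<in>J \<times> J. c a b * (A * S * A) $$ (b, a))"
  proof (rule sum.cong)
    fix p assume "p \<in> J \<times> J"
    then have "fst p \<in> J" "snd p \<in> J" "fst p < n" "snd p < n" using J by auto
    then show "?C $$ p * (A * S * A) $$ (snd p, fst p) = (case p of (a, b) \<Rightarrow> c a b * (A * S * A) $$ (b, a))"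
      by (cases p) simp
  qed simp
  finally show ?thesis .
qed

text \<open>The dimension count, detached from representation theory: \<open>S q\<close> holds the
  blocks of the q-th constraint, and \<open>adj\<close> makes the solution space stable under
  adjoints. The result is phrased with D, not C, because \<open>positive_mat_perturbation\<close>
  takes directions of the form X^H D X.\<close>

lemma hermitian_perturbation_exists:
  fixes X :: "'w \<Rightarrow> complex mat" and S :: "'q \<Rightarrow> 'w \<Rightarrow> complex mat"
  assumes fin: "finite \<Omega>" "finite Q"
    and X: "\<And>\<omega>. \<omega> \<in> \<Omega> \<Longrightarrow> X \<omega> \<in> carrier_mat (n \<omega>) (n \<omega>)"
    and S: "\<And>q \<omega>. q \<in> Q \<Longrightarrow> \<omega> \<in> \<Omega> \<Longrightarrow> S q \<omega> \<in> carrier_mat (n \<omega>) (n \<omega>)"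
    and adj: "\<And>q. q \<in> Q \<Longrightarrow> \<exists>q'\<in>Q. \<forall>\<omega>\<in>\<Omega>. S q' \<omega> = mat_adjoint (S q \<omega>)"
    and card: "card Q < (\<Sum>\<omega>\<in>\<Omega>. (vec_space.rank (n \<omega>) (X \<omega>))\<^sup>2)"
  shows "\<exists>D. (\<forall>\<omega>\<in>\<Omega>. D \<omega> \<in> carrier_mat (n \<omega>) (n \<omega>) \<and> mat_adjoint (D \<omega>) = D \<omega>) \<and>
    (\<exists>\<omega>\<in>\<Omega>. mat_adjoint (X \<omega>) * D \<omega> * X \<omega> \<noteq> 0\<^sub>m (n \<omega>) (n \<omega>)) \<and>
    (\<forall>q\<in>Q. (\<Sum>\<omega>\<in>\<Omega>. mat_trace (S q \<omega> * (mat_adjoint (X \<omega>) * D \<omega> * X \<omega>))) = 0)"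
proof -
  have "\<forall>\<omega>\<in>\<Omega>. \<exists>J. J \<subseteq> {..<n \<omega>} \<and> card J = vec_space.rank (n \<omega>) (X \<omega>) \<and>
    (\<forall>v\<in>carrier_vec (n \<omega>). (\<forall>j<n \<omega>. j \<notin> J \<longrightarrow> v $ j = 0) \<longrightarrow>
       X \<omega> *\<^sub>v v = 0\<^sub>v (n \<omega>) \<longrightarrow> v = 0\<^sub>v (n \<omega>))"
    by (intro ballI, rule rank_column_index_set[OF X], assumption) blast
  then obtain J where J: "\<And>\<omega>. \<omega> \<in> \<Omega> \<Longrightarrow> J \<omega> \<subseteq> {..<n \<omega>}"
      "\<And>\<omega>. \<omega> \<in> \<Omega> \<Longrightarrow> card (J \<omega>) = vec_space.rank (n \<omega>) (X \<omega>)"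
    and inj: "\<And>\<omega> v. \<omega> \<in> \<Omega> \<Longrightarrow> v \<in> carrier_vec (n \<omega>) \<Longrightarrow>
       (\<And>j. j < n \<omega> \<Longrightarrow> j \<notin> J \<omega> \<Longrightarrow> v $ j = 0) \<Longrightarrow>
       X \<omega> *\<^sub>v v = 0\<^sub>v (n \<omega>) \<Longrightarrow> v = 0\<^sub>v (n \<omega>)"
    by (subst (asm) bchoice_iff) blast
  have finJ: "finite (J \<omega>)" if "\<omega> \<in> \<Omega>" for \<omega> using J(1)[OF that] finite_subset by blast
  define A where "A \<omega> = mat_adjoint (X \<omega>) * X \<omega>" for \<omega>
  have A: "A \<omega> \<in> carrier_mat (n \<omega>) (n \<omega>)" "mat_adjoint (A \<omega>) = A \<omega>" if "\<omega> \<in> \<Omega>" for \<omega>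
    using X[OF that] adjoint_mult[OF adjoint_carrier[OF X[OF that]] X[OF that]]
    by (auto simp: A_def)
  \<comment> \<open>One unknown for each position in \<open>J \<omega> \<times> J \<omega>\<close>
    of each block, hence sum of r^2 unknowns in total.\<close>
  define P where "P = (SIGMA \<omega>:\<Omega>. J \<omega> \<times> J \<omega>)"
  have "card P = (\<Sum>\<omega>\<in>\<Omega>. (vec_space.rank (n \<omega>) (X \<omega>))\<^sup>2)"
    unfolding P_def using fin finJ J(2)
    by (simp add: card_cartesian_product power2_eq_square)
  moreover have "finite P" unfolding P_def using fin finJ by auto
  ultimately obtain c where c: "\<exists>p\<in>P. c p \<noteq> 0"
      "\<And>q. q \<in> Q \<Longrightarrow> (\<Sum>(\<omega>, a, b)\<in>P. c (\<omega>, a, b) * (A \<omega> * S q \<omega> * A \<omega>) $$ (b, a)) = 0"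
    using homogeneous_system_nontrivial_solution[OF fin(2), of P
        "\<lambda>q (\<omega>, a, b). (A \<omega> * S q \<omega> * A \<omega>) $$ (b, a)"] card
    by (auto simp: case_prod_unfold)
  define C where "C \<omega> = mat (n \<omega>) (n \<omega>)
    (\<lambda>(a, b). if a \<in> J \<omega> \<and> b \<in> J \<omega> then c (\<omega>, a, b) else 0)" for \<omega>
  have C: "C \<omega> \<in> carrier_mat (n \<omega>) (n \<omega>)" for \<omega> by (simp add: C_def)
  have trC: "(\<Sum>\<omega>\<in>\<Omega>. mat_trace (S q \<omega> * (A \<omega> * C \<omega> * A \<omega>))) = 0" if q: "q \<in> Q" for q
  proof -
    have "(\<Sum>\<omega>\<in>\<Omega>. mat_trace (S q \<omega> * (A \<omega> * C \<omega> * A \<omega>)))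
      = (\<Sum>\<omega>\<in>\<Omega>. \<Sum>(a, b)\<in>J \<omega> \<times> J \<omega>. c (\<omega>, a, b) * (A \<omega> * S q \<omega> * A \<omega>) $$ (b, a))"
      unfolding C_def
      by (intro sum.cong refl compressed_trace_entries S[OF q] A(1) J(1))
    also have "\<dots> = (\<Sum>(\<omega>, a, b)\<in>P. c (\<omega>, a, b) * (A \<omega> * S q \<omega> * A \<omega>) $$ (b, a))"
      unfolding P_def by (subst sum.Sigma) (use fin finJ in auto)
    finally show ?thesis using c(2)[OF q] by simp
  qed
  have trC': "(\<Sum>\<omega>\<in>\<Omega>. mat_trace (S q \<omega> * (A \<omega> * mat_adjoint (C \<omega>) * A \<omega>))) = 0" if q: "q \<in> Q" for q
  proof -
    obtain q' where q': "q' \<in> Q" "\<And>\<omega>. \<omega> \<in> \<Omega> \<Longrightarrow> S q' \<omega> = mat_adjoint (S q \<omega>)" using adj[OF q] by auto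
    have "(\<Sum>\<omega>\<in>\<Omega>. mat_trace (S q \<omega> * (A \<omega> * mat_adjoint (C \<omega>) * A \<omega>)))
      = (\<Sum>\<omega>\<in>\<Omega>. cnj (mat_trace (S q' \<omega> * (A \<omega> * C \<omega> * A \<omega>))))"
      by (intro sum.cong refl) (simp add: q'(2) compressed_trace_adjoint[OF S[OF q] A(1) C A(2)])
    also have "\<dots> = cnj (\<Sum>\<omega>\<in>\<Omega>. mat_trace (S q' \<omega> * (A \<omega> * C \<omega> * A \<omega>)))" by simp
    finally show ?thesis using trC[OF q'(1)] by simp
  qed
  from c(1) obtain \<omega>0 a0 b0 where "(\<omega>0, a0, b0) \<in> P" and nz: "c (\<omega>0, a0, b0) \<noteq> 0" by auto
  then have w0: "\<omega>0 \<in> \<Omega>" and ab: "a0 \<in> J \<omega>0" "b0 \<in> J \<omega>0" by (auto simp: P_def)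
  with J(1) have ab': "a0 < n \<omega>0" "b0 < n \<omega>0" by auto
  (* E 1 and E \<i> are, up to factors, the Hermitian and anti-Hermitian parts of C, so they do not
     both vanish. *)
  define E where "E z \<omega> = z \<cdot>\<^sub>m C \<omega> + cnj z \<cdot>\<^sub>m mat_adjoint (C \<omega>)" for z \<omega>
  have E: "E z \<omega> \<in> carrier_mat (n \<omega>) (n \<omega>)" for z \<omega> using C[of \<omega>] by (auto simp: E_def)
  have E': "mat_adjoint (E z \<omega>) = E z \<omega>" for z \<omega>
    using C[of \<omega>] by (intro eq_matI) (auto simp: E_def)
  have suppE: "E z \<omega> $$ (i, j) = 0" if "i < n \<omega>" "i \<notin> J \<omega>" "j < n \<omega>" for z \<omega> i j
    using that by (simp add: E_def C_def)
  have trE: "(\<Sum>\<omega>\<in>\<Omega>. mat_trace (S q \<omega> * (A \<omega> * E z \<omega> * A \<omega>))) = 0" if q: "q \<in> Q" for q z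
  proof -
    have "(\<Sum>\<omega>\<in>\<Omega>. mat_trace (S q \<omega> * (A \<omega> * E z \<omega> * A \<omega>)))
      = (\<Sum>\<omega>\<in>\<Omega>. z * mat_trace (S q \<omega> * (A \<omega> * C \<omega> * A \<omega>))
          + cnj z * mat_trace (S q \<omega> * (A \<omega> * mat_adjoint (C \<omega>) * A \<omega>)))"
      by (intro sum.cong refl)
        (simp add: E_def compressed_trace_add[OF S[OF q] A(1) C adjoint_carrier[OF C]])
    then show ?thesis using trC[OF q] trC'[OF q]
      by (simp add: sum.distrib sum_distrib_left[symmetric])
  qed
  have "\<exists>z. E z \<omega>0 $$ (a0, b0) \<noteq> 0"
  proof (rule ccontr)
    assume "\<nexists>z. E z \<omega>0 $$ (a0, b0) \<noteq> 0"
    then have *: "z * C \<omega>0 $$ (a0, b0) + cnj z * cnj (C \<omega>0 $$ (b0, a0)) = 0" for z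
      using ab' C[of \<omega>0] by (auto simp: E_def)
    have "C \<omega>0 $$ (a0, b0) = 0" using *[of 1] *[of \<i>] by simp
    then show False using nz ab ab' by (simp add: C_def)
  qed
  then obtain z where z: "E z \<omega>0 \<noteq> 0\<^sub>m (n \<omega>0) (n \<omega>0)" using ab' by (metis index_zero_mat(1))
  \<comment> \<open>Chosen so that X^H D X = A E A, the shape in which the constraints were
    solved.\<close>
  define D where "D \<omega> = X \<omega> * E z \<omega> * mat_adjoint (X \<omega>)" for \<omega>
  have XDX: "mat_adjoint (X \<omega>) * D \<omega> * X \<omega> = A \<omega> * E z \<omega> * A \<omega>" if "\<omega> \<in> \<Omega>" for \<omega>
  proof -
    have "L * (R * F * L) * R = L * R * F * (L * R)"
      if "L \<in> carrier_mat k k" "R \<in> carrier_mat k k" "F \<in> carrier_mat k k" for L R F :: "complex mat" and k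
      using that by (simp add: assoc_mult_mat[of _ k k _ k _ k])
    from this[OF adjoint_carrier[OF X[OF that]] X[OF that] E] show ?thesis
      unfolding D_def A_def .
  qed
  show ?thesis
  proof (intro exI[of _ D] conjI ballI)
    fix \<omega> assume w: "\<omega> \<in> \<Omega>"
    note X = X[OF w]
    show "D \<omega> \<in> carrier_mat (n \<omega>) (n \<omega>)" unfolding D_def using X E[of z \<omega>] by auto
    show "mat_adjoint (D \<omega>) = D \<omega>" unfolding D_def using X E[of z \<omega>] E'[of z \<omega>]
      by (simp add: adjoint_mult[of _ "n \<omega>" "n \<omega>" _ "n \<omega>"] assoc_mult_mat[of _ "n \<omega>" "n \<omega>" _ "n \<omega>" _ "n \<omega>"])
  next
    have "A \<omega>0 * E z \<omega>0 * A \<omega>0 \<noteq> 0\<^sub>m (n \<omega>0) (n \<omega>0)"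
      using compressed_eq_0[OF X[OF w0] E E' inj[OF w0] suppE] z unfolding A_def by blast
    then show "\<exists>\<omega>\<in>\<Omega>. mat_adjoint (X \<omega>) * D \<omega> * X \<omega> \<noteq> 0\<^sub>m (n \<omega>) (n \<omega>)"
      using w0 XDX by metis
  next
    fix q assume "q \<in> Q"
    then show "(\<Sum>\<omega>\<in>\<Omega>. mat_trace (S q \<omega> * (mat_adjoint (X \<omega>) * D \<omega> * X \<omega>))) = 0"
      using trE XDX by simp
  qed
qed


section \<open>Orthogonal decompositions and partial isometries\<close>

lemma is_subspaceD:
  assumes "is_subspace N V"
  shows "V \<subseteq> carrier_vec N" "0\<^sub>v N \<in> V"
    "\<And>v w. v \<in> V \<Longrightarrow> w \<in> V \<Longrightarrow> v + w \<in> V" "\<And>c v. v \<in> V \<Longrightarrow> c \<cdot>\<^sub>v v \<in> V"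
proof -
  have *: "submodule class_ring V (module_vec TYPE(complex) N)"
    using assms by (simp add: VectorSpace.subspace_def)
  show "V \<subseteq> carrier_vec N" "0\<^sub>v N \<in> V"
    "\<And>v w. v \<in> V \<Longrightarrow> w \<in> V \<Longrightarrow> v + w \<in> V" "\<And>c v. v \<in> V \<Longrightarrow> c \<cdot>\<^sub>v v \<in> V"
    using submodule.subset[OF *] submodule.zero_closed[OF *] submodule.m_closed[OF *]
      submodule.smult_closed[OF *]
    by (auto simp: module_vec_simps)
qed

(* The vectors splitting along F j and its orthogonal complement form a subspace containing every
   F i, so no projection theorem is needed. *)
lemma orthogonal_decompositionE:
  assumes dec: "orthogonal_decomposition N J F" and j: "j \<in> J" and v: "v \<in> carrier_vec N"
  obtains x y where "v = x + y" "x \<in> F j" "y \<in> carrier_vec N" "\<And>w. w \<in> F j \<Longrightarrow> y \<bullet>c w = 0"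
proof -
  interpret vec_space "TYPE(complex)" N .
  have sub: "\<And>i. i \<in> J \<Longrightarrow> is_subspace N (F i)"
    and orth: "\<And>i v w. i \<in> J \<Longrightarrow> i \<noteq> j \<Longrightarrow> v \<in> F i \<Longrightarrow> w \<in> F j \<Longrightarrow> v \<bullet>c w = 0"
    and span: "span (\<Union>i\<in>J. F i) = carrier_vec N"
    using dec j by (auto simp: orthogonal_decomposition_def)
  note Fj = is_subspaceD[OF sub[OF j]]
  define Z where "Z = {x + y |x y. x \<in> F j \<and> y \<in> carrier_vec N \<and> (\<forall>w\<in>F j. y \<bullet>c w = 0)}"
  have ZI: "x + y \<in> Z" if "x \<in> F j" "y \<in> carrier_vec N" "\<And>w. w \<in> F j \<Longrightarrow> y \<bullet>c w = 0" for x y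
    using that by (auto simp: Z_def)
  have zero: "0\<^sub>v N \<bullet>c w = 0" if "w \<in> F j" for w using Fj(1) that by auto
  have "submodule class_ring Z V" (is ?sub)
  proof (rule submodule.intro)
    show "module class_ring V" by (rule module_axioms)
    show "Z \<subseteq> carrier V" using Fj(1) by (auto simp: Z_def)
    show "\<zero>\<^bsub>V\<^esub> \<in> Z" using ZI[of "0\<^sub>v N" "0\<^sub>v N"] Fj(2) zero by (simp add: module_vec_simps)
    fix v w assume "v \<in> Z" "w \<in> Z"
    then obtain x y x' y' where *: "v = x + y" "x \<in> F j" "y \<in> carrier_vec N" "\<forall>u\<in>F j. y \<bullet>c u = 0"
      "w = x' + y'" "x' \<in> F j" "y' \<in> carrier_vec N" "\<forall>u\<in>F j. y' \<bullet>c u = 0" by (auto simp: Z_def)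
    have c: "x \<in> carrier_vec N" "x' \<in> carrier_vec N" using * Fj(1) by auto
    have "v + w = (x + x') + (y + y')" unfolding * using * c by (intro eq_vecI) auto
    moreover have "(x + x') + (y + y') \<in> Z"
    proof (rule ZI)
      fix u assume u: "u \<in> F j"
      then have "u \<in> carrier_vec N" using Fj(1) by auto
      then show "(y + y') \<bullet>c u = 0" using * u by (simp add: add_scalar_prod_distrib[of _ N])
    qed (use * Fj in auto)
    ultimately show "v \<oplus>\<^bsub>V\<^esub> w \<in> Z" by (simp add: module_vec_simps)
  next
    fix c v assume "v \<in> Z"
    then obtain x y where *: "v = x + y" "x \<in> F j" "y \<in> carrier_vec N" "\<forall>u\<in>F j. y \<bullet>c u = 0"
      by (auto simp: Z_def)
    have x: "x \<in> carrier_vec N" using * Fj(1) by auto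
    have "c \<cdot>\<^sub>v v = c \<cdot>\<^sub>v x + c \<cdot>\<^sub>v y" using * x by (simp add: smult_add_distrib_vec[of _ N])
    moreover have "c \<cdot>\<^sub>v x + c \<cdot>\<^sub>v y \<in> Z"
    proof (rule ZI)
      fix u assume u: "u \<in> F j"
      then have "u \<in> carrier_vec N" using Fj(1) by auto
      then show "(c \<cdot>\<^sub>v y) \<bullet>c u = 0" using * u by simp
    qed (use * Fj in auto)
    ultimately show "c \<odot>\<^bsub>V\<^esub> v \<in> Z" by (simp add: module_vec_simps)
  qed
  have "(\<Union>i\<in>J. F i) \<subseteq> Z"
  proof safe
    fix i u assume i: "i \<in> J" and u: "u \<in> F i"
    have uc: "u \<in> carrier_vec N" using is_subspaceD(1)[OF sub[OF i]] u by auto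
    show "u \<in> Z"
    proof (cases "i = j")
      case True
      then show ?thesis using ZI[of u "0\<^sub>v N"] u uc zero by simp
    next
      case False
      then show ?thesis using ZI[of "0\<^sub>v N" u] orth[OF i] u uc Fj(2) by simp
    qed
  qed
  from span_is_subset[OF this \<open>?sub\<close>] have "v \<in> Z" unfolding span using v by (rule subsetD)
  then obtain x y where "v = x + y" "x \<in> F j" "y \<in> carrier_vec N" "\<forall>w\<in>F j. y \<bullet>c w = 0"
    unfolding Z_def by blast
  then show ?thesis by (intro that[of x y]) blast+
qed

text \<open>For v = x + y, with x in the support and y orthogonal to it, both quadratic forms reduce
  to <x, x>; polarisation then upgrades equality of forms to equality of operators. The
  decomposition serves to supply the splitting of v.\<close>

lemma partial_isometry_adjoint_mult:
  assumes dec: "orthogonal_decomposition N J F" and j: "j \<in> J"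
    and A: "partial_isometry N A (F j) V" and P: "orthogonal_projector N P (F j)"
  shows "mat_adjoint A * A = P"
proof -
  have Ac: "A \<in> carrier_mat N N" and Pc: "P \<in> carrier_mat N N"
    using A P by (auto simp: partial_isometry_def orthogonal_projector_def)
  let ?D = "mat_adjoint A * A - P"
  have AA: "mat_adjoint A * A \<in> carrier_mat N N" using Ac by auto
  have Dc: "?D \<in> carrier_mat N N" using Pc by auto
  have Fj: "F j \<subseteq> carrier_vec N"
    using dec j is_subspaceD(1) by (auto simp: orthogonal_decomposition_def)
  have "?D = 0\<^sub>m N N"
  proof (rule quadratic_form_eq_0[OF Dc])
    fix v :: "complex vec" assume v: "v \<in> carrier_vec N"
    obtain x y where xy: "v = x + y" "x \<in> F j" "y \<in> carrier_vec N" "\<And>w. w \<in> F j \<Longrightarrow> y \<bullet>c w = 0"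
      using orthogonal_decompositionE[OF dec j v] by metis
    have x: "x \<in> carrier_vec N" using xy Fj by auto
    have "A *\<^sub>v y = 0\<^sub>v N" "P *\<^sub>v y = 0\<^sub>v N" "P *\<^sub>v x = x" and iso: "(A *\<^sub>v x) \<bullet>c (A *\<^sub>v x) = x \<bullet>c x"
      using A P xy by (auto simp: partial_isometry_def orthogonal_projector_def)
    then have Av: "A *\<^sub>v v = A *\<^sub>v x" and Pv: "P *\<^sub>v v = x"
      using xy x Ac Pc by (simp_all add: mult_add_distrib_mat_vec[of _ N N])
    have xy0: "x \<bullet>c y = 0" using inner_commute[OF xy(3) x] xy(4)[OF xy(2)] by simp
    have "(mat_adjoint A * A *\<^sub>v v) \<bullet>c v = (A *\<^sub>v v) \<bullet>c (A *\<^sub>v v)"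
      using inner_adjoint[OF adjoint_carrier[OF Ac] _ v, of "A *\<^sub>v v"] Ac v
        assoc_mult_mat_vec[OF adjoint_carrier[OF Ac] Ac v] by simp
    also have "\<dots> = x \<bullet>c x" unfolding Av by (rule iso)
    also have "\<dots> = x \<bullet>c v"
      using xy x xy0 by (simp add: conjugate_add_vec[of _ N] scalar_prod_add_distrib[of _ N])
    finally have "(mat_adjoint A * A *\<^sub>v v) \<bullet>c v = (P *\<^sub>v v) \<bullet>c v" unfolding Pv .
    moreover have "?D *\<^sub>v v = mat_adjoint A * A *\<^sub>v v - P *\<^sub>v v"
      using minus_mult_distrib_mat_vec[OF AA Pc v] .
    ultimately show "(?D *\<^sub>v v) \<bullet>c v = 0"
      using AA Pc v by (simp add: minus_scalar_prod_distrib[of _ N])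
  qed
  then have "?D + P = 0\<^sub>m N N + P" by simp
  moreover have "?D + P = mat_adjoint A * A" using AA Pc by (intro eq_matI) auto
  ultimately show ?thesis using Pc by simp
qed

text \<open>N + 1 non-zero, mutually orthogonal vectors would have a linear dependence, as they
  solve N coordinate equations; pairing it with a vector whose coefficient is non-zero gives a
  contradiction. This yields finiteness of the sets of irrep classes, which are quotients of
  possibly infinite sets of subspaces.\<close>

lemma orthogonal_decomposition_finite:
  assumes dec: "orthogonal_decomposition N J F" and nz: "\<And>j. j \<in> J \<Longrightarrow> F j \<noteq> {0\<^sub>v N}"
  shows "finite J"
proof (rule ccontr)
  assume "infinite J"
  then obtain J' where J': "J' \<subseteq> J" "finite J'" "card J' = Suc N"
    using infinite_arbitrarily_large by blast
  have sub: "\<And>j. j \<in> J \<Longrightarrow> is_subspace N (F j)"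
    and orth: "\<And>i j v w. i \<in> J \<Longrightarrow> j \<in> J \<Longrightarrow> i \<noteq> j \<Longrightarrow> v \<in> F i \<Longrightarrow> w \<in> F j \<Longrightarrow> v \<bullet>c w = 0"
    using dec by (auto simp: orthogonal_decomposition_def)
  have "\<forall>j\<in>J. \<exists>v\<in>F j. v \<noteq> 0\<^sub>v N" using nz is_subspaceD(2)[OF sub] by blast
  then obtain x where x: "\<And>j. j \<in> J \<Longrightarrow> x j \<in> F j" "\<And>j. j \<in> J \<Longrightarrow> x j \<noteq> 0\<^sub>v N" by metis
  have xc: "x j \<in> carrier_vec N" if "j \<in> J" for j using is_subspaceD(1)[OF sub[OF that]] x that by blast
  obtain c where c: "\<exists>j\<in>J'. c j \<noteq> 0" "\<And>i. i < N \<Longrightarrow> (\<Sum>j\<in>J'. c j * x j $ i) = 0"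
    using homogeneous_system_nontrivial_solution[of "{..<N}" J' "\<lambda>i j. x j $ i"] J' by auto
  then obtain k where k: "k \<in> J'" "c k \<noteq> 0" by blast
  with J' have kJ: "k \<in> J" by auto
  have inner: "x j \<bullet>c x k = (\<Sum>i<N. x j $ i * cnj (x k $ i))" for j
    using xc[OF kJ] by (auto simp: scalar_prod_def atLeast0LessThan)
  have "0 = (\<Sum>i<N. (\<Sum>j\<in>J'. c j * x j $ i) * cnj (x k $ i))" using c(2) by simp
  also have "\<dots> = (\<Sum>j\<in>J'. c j * (x j \<bullet>c x k))"
    unfolding inner sum_distrib_right sum_distrib_left
    by (subst sum.swap) (simp add: mult.assoc)
  also have "\<dots> = (\<Sum>j\<in>J'. if j = k then c k * (x k \<bullet>c x k) else 0)"
    using J'(1) kJ by (intro sum.cong) (auto simp: orth[OF _ _ _ x(1) x(1)])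
  also have "\<dots> = c k * (x k \<bullet>c x k)" using k J'(2) by simp
  finally have "x k \<bullet>c x k = 0" using k by simp
  then show False using conjugate_square_eq_0_vec[OF xc[OF kJ]] x(2)[OF kJ] by simp
qed


section \<open>The blocks of the invariant isomorphisms\<close>

lemma irreps_of_class: "\<mu> \<in> irrep_classes N K U \<Longrightarrow> V \<in> \<mu> \<Longrightarrow> V \<in> irreps N K U"
  by (auto simp: irrep_classes_def irrep_equiv_def elim!: quotientE)

lemma irreducible_decomposition_finite:
  assumes "irreducible_decomposition N K U m H"
  shows "finite (irrep_classes N K U)"
proof -
  let ?J = "SIGMA \<mu>:irrep_classes N K U. {1..m \<mu>}"
  have pos: "\<And>\<mu>. \<mu> \<in> irrep_classes N K U \<Longrightarrow> 0 < m \<mu>"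
    and mem: "\<And>\<mu> k. \<mu> \<in> irrep_classes N K U \<Longrightarrow> k \<in> {1..m \<mu>} \<Longrightarrow> H \<mu> k \<in> \<mu>"
    and dec: "orthogonal_decomposition N ?J (\<lambda>(\<mu>, k). H \<mu> k)"
    using assms by (auto simp: irreducible_decomposition_def)
  have "finite ?J"
  proof (rule orthogonal_decomposition_finite[OF dec])
    fix j assume "j \<in> ?J"
    then obtain \<mu> k where j: "j = (\<mu>, k)" "\<mu> \<in> irrep_classes N K U" "k \<in> {1..m \<mu>}" by auto
    then show "(case j of (\<mu>, k) \<Rightarrow> H \<mu> k) \<noteq> {0\<^sub>v N}"
      using irreps_of_class[OF j(2) mem[OF j(2,3)]] by (simp add: irreps_def)
  qed
  moreover have "irrep_classes N K U \<subseteq> fst ` ?J" using pos by force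
  ultimately show ?thesis using finite_surj by blast
qed

text \<open>What needs care is that the isotypic components are non-zero, which requires
  \<open>class_dim\<close> to be positive. That number is a definite description, so positivity is
  read off from a matrix with that many columns whose range is an irrep: with no columns its range
  would be zero.\<close>

lemma tensor_decomposition_finite:
  assumes "tensor_decomposition N K U m R W"
  shows "finite (irrep_classes N K U)"
proof (rule orthogonal_decomposition_finite)
  show "orthogonal_decomposition N (irrep_classes N K U) (\<lambda>\<nu>. mat_range (W \<nu>))"
    using assms by (simp add: tensor_decomposition_def)
  fix \<nu> assume nu: "\<nu> \<in> irrep_classes N K U"
  let ?d = "class_dim N \<nu>"
  have m: "0 < m \<nu>" and W: "W \<nu> \<in> carrier_mat N (?d * m \<nu>)"
    and iso: "mat_adjoint (W \<nu>) * W \<nu> = 1\<^sub>m (?d * m \<nu>)"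
    using assms nu by (auto simp: tensor_decomposition_def)
  obtain L where L: "L \<in> carrier_mat N ?d" "mat_range L \<in> \<nu>"
    using assms nu by (auto simp: tensor_decomposition_def matrix_irrep_of_class_def)
  have "mat_range L \<noteq> {0\<^sub>v N}" using irreps_of_class[OF nu L(2)] by (auto simp: irreps_def)
  then have "?d \<noteq> 0"
  proof (rule contrapos_nn)
    assume "?d = 0"
    then have *: "L *\<^sub>v v = 0\<^sub>v N" if "v \<in> carrier_vec (dim_col L)" for v
      using L that by (intro eq_vecI) (auto simp: scalar_prod_def)
    have "mat_range L = (\<lambda>_ :: complex vec. 0\<^sub>v N) ` carrier_vec (dim_col L)" by (rule image_cong) (simp_all add: *)
    also have "\<dots> = {0\<^sub>v N}" by (rule image_constant[OF zero_carrier_vec])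
    finally show "mat_range L = {0\<^sub>v N}" .
  qed
  with m have pos: "0 < ?d * m \<nu>" by simp
  let ?e = "unit_vec (?d * m \<nu>) 0 :: complex vec"
  show "mat_range (W \<nu>) \<noteq> {0\<^sub>v N}"
  proof
    assume "mat_range (W \<nu>) = {0\<^sub>v N}"
    then have "W \<nu> *\<^sub>v ?e = 0\<^sub>v N" using W by auto
    then have "mat_adjoint (W \<nu>) * W \<nu> *\<^sub>v ?e = 0\<^sub>v (?d * m \<nu>)"
      using W assoc_mult_mat_vec[OF adjoint_carrier[OF W] W, of ?e] by (auto simp: scalar_prod_def intro!: eq_vecI)
    then have "?e = 0\<^sub>v (?d * m \<nu>)" unfolding iso by simp
    then have "?e $ 0 = 0\<^sub>v (?d * m \<nu>) $ 0" by simp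
    then show False using pos by simp
  qed
qed

text \<open>The initial projection T_ll factors as T_kl^H T_kl, so T_lk = T_ll T_lk = T_kl^H T_kk.
  Since T_kk is Hermitian, this is the adjoint of T_kk T_kl = T_kl.\<close>

lemma invariant_isomorphisms_adjoint:
  assumes dec: "irreducible_decomposition N K U m H" and T: "invariant_isomorphisms N K U m H T"
    and mu: "\<mu> \<in> irrep_classes N K U" and k: "k \<in> {1..m \<mu>}" and l: "l \<in> {1..m \<mu>}"
  shows "mat_adjoint (T \<mu> k l) = T \<mu> l k"
proof -
  have dec': "orthogonal_decomposition N (SIGMA \<mu>:irrep_classes N K U. {1..m \<mu>}) (\<lambda>(\<mu>, k). H \<mu> k)"
    using dec by (simp add: irreducible_decomposition_def)
  have iso: "partial_isometry N (T \<mu> a b) (H \<mu> b) (H \<mu> a)"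
    and proj: "orthogonal_projector N (T \<mu> a a) (H \<mu> a)"
    and prod: "T \<mu> a b * T \<mu> b c = T \<mu> a c"
    if "a \<in> {1..m \<mu>}" "b \<in> {1..m \<mu>}" "c \<in> {1..m \<mu>}" for a b c
    using T mu that by (auto simp: invariant_isomorphisms_def)
  have Tc: "T \<mu> a b \<in> carrier_mat N N" if "a \<in> {1..m \<mu>}" "b \<in> {1..m \<mu>}" for a b
    using iso[OF that that(1)] by (simp add: partial_isometry_def)
  have adj: "mat_adjoint (T \<mu> a b) * T \<mu> a b = T \<mu> b b" if "a \<in> {1..m \<mu>}" "b \<in> {1..m \<mu>}" for a b
    using partial_isometry_adjoint_mult[OF dec', of "(\<mu>, b)" "T \<mu> a b" "H \<mu> a" "T \<mu> b b"]
      iso[OF that that(1)] proj[OF that(2) that(2) that(2)] mu that by simp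
  \<comment> \<open>T_kk equals T_kk^H T_kk, and is therefore Hermitian.\<close>
  have kk: "mat_adjoint (T \<mu> k k) = T \<mu> k k"
    using adjoint_mult[OF adjoint_carrier[OF Tc[OF k k]] Tc[OF k k]] adj[OF k k] by simp
  have "T \<mu> l k = T \<mu> l l * T \<mu> l k" using prod[OF l l k] by simp
  also have "\<dots> = mat_adjoint (T \<mu> k l) * (T \<mu> k l * T \<mu> l k)"
    unfolding adj[OF k l, symmetric]
    by (rule assoc_mult_mat[OF adjoint_carrier[OF Tc[OF k l]] Tc[OF k l] Tc[OF l k]])
  also have "\<dots> = mat_adjoint (T \<mu> k l) * mat_adjoint (T \<mu> k k)" using prod[OF k l k] kk by simp
  also have "\<dots> = mat_adjoint (T \<mu> k k * T \<mu> k l)" using adjoint_mult[OF Tc[OF k k] Tc[OF k l]] by simp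
  also have "\<dots> = mat_adjoint (T \<mu> k l)" using prod[OF k k l] by simp
  finally show ?thesis by simp
qed

section \<open>Adjoints of partial traces and of the constraint blocks\<close>

lemma S_block_carrier: "S_block N mI W T (i, \<nu>) \<in> carrier_mat (mI i \<nu>) (mI i \<nu>)"
  by (simp add: S_block_def partial_trace_def)

lemma partial_trace_adjoint:
  assumes "M \<in> carrier_mat (d * m) (d * m)"
  shows "partial_trace d m (mat_adjoint M) = mat_adjoint (partial_trace d m M)"
proof -
  have "a * m + b < d * m" if "a < d" "b < m" for a b
  proof -
    have "a * m + b < Suc a * m" using that by simp
    also have "\<dots> \<le> d * m" using that by (intro mult_le_mono1) simp
    finally show ?thesis .
  qed
  then show ?thesis using assms by (intro eq_matI) (auto simp: partial_trace_def)
qed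

text \<open>Compression by the Hermitian isotypic projector, transport by W and partial trace all
  commute with adjoints. Together with the adjoint law for T, this makes the constraint with indices
  l, k the adjoint of the one with indices k, l.\<close>

lemma S_block_adjoint:
  assumes W: "W i \<nu> \<in> carrier_mat N (class_dim N \<nu> * mI i \<nu>)" and T: "T \<in> carrier_mat N N"
  shows "S_block N mI W (mat_adjoint T) (i, \<nu>) = mat_adjoint (S_block N mI W T (i, \<nu>))"
proof -
  let ?W = "W i \<nu>" and ?n = "class_dim N \<nu> * mI i \<nu>"
  let ?P = "isotypic_projector ?W"
  have W': "mat_adjoint ?W \<in> carrier_mat ?n N" using W by simp
  have P: "?P \<in> carrier_mat N N" "mat_adjoint ?P = ?P"
    using W W' adjoint_mult[OF W W'] by (auto simp: isotypic_projector_def)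
  have PT: "?P * T \<in> carrier_mat N N" "?P * T * ?P \<in> carrier_mat N N"
    "mat_adjoint ?W * (?P * T * ?P) \<in> carrier_mat ?n N" using P T W' by auto
  have PTP: "mat_adjoint (?P * T * ?P) = ?P * mat_adjoint T * ?P"
    using P T PT by (simp add: adjoint_mult[of _ N N _ N] assoc_mult_mat[of _ N N _ N _ N])
  have "mat_adjoint (mat_adjoint ?W * (?P * T * ?P) * ?W)
      = mat_adjoint ?W * (mat_adjoint (?P * T * ?P) * ?W)"
    using adjoint_mult[OF PT(3) W] adjoint_mult[OF W' PT(2)] by simp
  also have "\<dots> = mat_adjoint ?W * (?P * mat_adjoint T * ?P) * ?W"
    unfolding PTP using W W' P T
    by (intro assoc_mult_mat[symmetric, of _ ?n N _ N _ ?n]) auto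
  finally have "mat_adjoint ?W * (?P * mat_adjoint T * ?P) * ?W
     = mat_adjoint (mat_adjoint ?W * (?P * T * ?P) * ?W)" by simp
  then show ?thesis
    using partial_trace_adjoint[OF mult_carrier_mat[OF PT(3) W]] by (simp add: S_block_def)
qed

section \<open>The rank bound at an extreme point\<close>

lemma extreme_block_operatorD:
  assumes "extreme_block_operator \<Omega> D A" "B \<in> D" "C \<in> D" "0 < t" "t < 1"
    "A = (\<lambda>\<omega>\<in>\<Omega>. complex_of_real (1 - t) \<cdot>\<^sub>m B \<omega> + complex_of_real t \<cdot>\<^sub>m C \<omega>)"
  shows "B = C"
  using assms unfolding extreme_block_operator_def by blast

theorem corollary3:
  fixes G :: "'g monoid"
    and TG :: "'g topology"
    and N :: nat
    and U :: "'g \<Rightarrow> complex mat"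
    and m :: "irrep_class \<Rightarrow> nat"
    and H :: "irrep_class \<Rightarrow> nat \<Rightarrow> complex vec set"
    and T :: "irrep_class \<Rightarrow> nat \<Rightarrow> nat \<Rightarrow> complex mat"
    and I :: "'i set"
    and K :: "'i \<Rightarrow> 'g set"
    and mI :: "'i \<Rightarrow> irrep_class \<Rightarrow> nat"
    and R :: "'i \<Rightarrow> irrep_class \<Rightarrow> 'g \<Rightarrow> complex mat"
    and W :: "'i \<Rightarrow> irrep_class \<Rightarrow> complex mat"
    and X :: "'i \<times> irrep_class \<Rightarrow> complex mat"
  assumes "compact_Lie_group G TG"
    and "projective_unitary_rep G TG N U"
    and "irreducible_decomposition N (carrier G) U m H"
    and "invariant_isomorphisms N (carrier G) U m H T"
    and "finite I"
    and "\<And>i. i \<in> I \<Longrightarrow> subgroup (K i) G \<and> compactin TG (K i)"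
    and "\<And>i. i \<in> I \<Longrightarrow> tensor_decomposition N (K i) U (mI i) (R i) (W i)"
    and "\<And>i \<nu>. (i, \<nu>) \<in> Omega N U I K \<Longrightarrow> X (i, \<nu>) \<in> carrier_mat (mI i \<nu>) (mI i \<nu>)"
    and "extreme_block_operator (Omega N U I K)
           (covariant_seeds N (carrier G) U m T (Omega N U I K) mI W)
           (\<lambda>\<omega>\<in>Omega N U I K. mat_adjoint (X \<omega>) * X \<omega>)"
  shows "(\<Sum>i\<in>I. \<Sum>\<nu>\<in>irrep_classes N (K i) U. (vec_space.rank (mI i \<nu>) (X (i, \<nu>)))\<^sup>2)
           \<le> (\<Sum>\<mu>\<in>irrep_classes N (carrier G) U. (m \<mu>)\<^sup>2)"
proof (rule ccontr)
  assume not_le: "\<not> ?thesis"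
  note dec = assms(3) and T = assms(4) and fI = assms(5) and tdec = assms(7) and X = assms(8)
    and extreme = assms(9)
  let ?cl = "irrep_classes N (carrier G) U"
  let ?\<Omega> = "Omega N U I K"
  let ?D = "covariant_seeds N (carrier G) U m T ?\<Omega> mI W"
  define n where "n = (\<lambda>(i, \<nu>). mI i \<nu>)"
  have n [simp]: "n (i, \<nu>) = mI i \<nu>" for i \<nu> by (simp add: n_def)
  \<comment> \<open>One complex equation per triple, so that \<open>card Q\<close> is the right-hand
    side of the claim.\<close>
  define Q where "Q = (SIGMA \<mu>:?cl. {1..m \<mu>} \<times> {1..m \<mu>})"
  define S where "S = (\<lambda>(\<mu>, k, l) \<omega>. S_block N mI W (T \<mu> k l) \<omega>)"
  define A where "A = (\<lambda>\<omega>\<in>?\<Omega>. mat_adjoint (X \<omega>) * X \<omega>)"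
  have fcl: "finite ?cl" by (rule irreducible_decomposition_finite[OF dec])
  have f\<Omega>: "finite ?\<Omega>" using fI tensor_decomposition_finite[OF tdec] by auto
  have fQ: "finite Q" using fcl by (auto simp: Q_def)
  have X': "X \<omega> \<in> carrier_mat (n \<omega>) (n \<omega>)" if "\<omega> \<in> ?\<Omega>" for \<omega>
    using X that by (cases \<omega>) auto
  have S': "S q \<omega> \<in> carrier_mat (n \<omega>) (n \<omega>)" for q \<omega>
    by (cases \<omega>) (auto simp: S_def S_block_carrier split: prod.split)
  have adj: "\<exists>q'\<in>Q. \<forall>\<omega>\<in>?\<Omega>. S q' \<omega> = mat_adjoint (S q \<omega>)" if qQ: "q \<in> Q" for q
  proof -
    obtain \<mu> k l where q: "q = (\<mu>, k, l)" "\<mu> \<in> ?cl" "k \<in> {1..m \<mu>}" "l \<in> {1..m \<mu>}"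
      using qQ by (auto simp: Q_def)
    have Tc: "T \<mu> k l \<in> carrier_mat N N"
      using T q by (auto simp: invariant_isomorphisms_def partial_isometry_def)
    have "S (\<mu>, l, k) \<omega> = mat_adjoint (S q \<omega>)" if w\<Omega>: "\<omega> \<in> ?\<Omega>" for \<omega>
    proof -
      obtain i \<nu> where w: "\<omega> = (i, \<nu>)" "i \<in> I" "\<nu> \<in> irrep_classes N (K i) U" using w\<Omega> by auto
      have "W i \<nu> \<in> carrier_mat N (class_dim N \<nu> * mI i \<nu>)"
        using tdec[OF w(2)] w(3) by (simp add: tensor_decomposition_def)
      from S_block_adjoint[where mI = mI and W = W, OF this Tc] show ?thesis
        using invariant_isomorphisms_adjoint[OF dec T q(2-4)] by (simp add: S_def q w)
    qed
    then show ?thesis using q by (intro bexI[of _ "(\<mu>, l, k)"]) (auto simp: Q_def)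
  qed
  have "card Q = (\<Sum>\<mu>\<in>?cl. (m \<mu>)\<^sup>2)"
    using fcl by (simp add: Q_def power2_eq_square)
  moreover have "(\<Sum>i\<in>I. \<Sum>\<nu>\<in>irrep_classes N (K i) U. (vec_space.rank (mI i \<nu>) (X (i, \<nu>)))\<^sup>2)
      = (\<Sum>\<omega>\<in>?\<Omega>. (vec_space.rank (n \<omega>) (X \<omega>))\<^sup>2)"
    using fI tensor_decomposition_finite[OF tdec] by (subst sum.Sigma) (auto intro!: sum.cong)
  ultimately have card: "card Q < (\<Sum>\<omega>\<in>?\<Omega>. (vec_space.rank (n \<omega>) (X \<omega>))\<^sup>2)"
    using not_le by simp
  obtain D where D: "\<And>\<omega>. \<omega> \<in> ?\<Omega> \<Longrightarrow> D \<omega> \<in> carrier_mat (n \<omega>) (n \<omega>)"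
      "\<And>\<omega>. \<omega> \<in> ?\<Omega> \<Longrightarrow> mat_adjoint (D \<omega>) = D \<omega>"
    and nz: "\<exists>\<omega>\<in>?\<Omega>. mat_adjoint (X \<omega>) * D \<omega> * X \<omega> \<noteq> 0\<^sub>m (n \<omega>) (n \<omega>)"
    and tr: "\<And>q. q \<in> Q \<Longrightarrow> (\<Sum>\<omega>\<in>?\<Omega>. mat_trace (S q \<omega> * (mat_adjoint (X \<omega>) * D \<omega> * X \<omega>))) = 0"
    using hermitian_perturbation_exists[OF f\<Omega> fQ X' S' adj card] by blast
  have "\<forall>\<omega>\<in>?\<Omega>. \<exists>c\<ge>0. \<forall>w\<in>carrier_vec (n \<omega>).
    Im ((D \<omega> *\<^sub>v w) \<bullet>c w) = 0 \<and> \<bar>Re ((D \<omega> *\<^sub>v w) \<bullet>c w)\<bar> \<le> c * Re (w \<bullet>c w)"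
    by (intro ballI hermitian_form_bound D)
  from bchoice[OF this] obtain c where c': "\<forall>\<omega>\<in>?\<Omega>. 0 \<le> c \<omega> \<and> (\<forall>w\<in>carrier_vec (n \<omega>).
    Im ((D \<omega> *\<^sub>v w) \<bullet>c w) = 0 \<and> \<bar>Re ((D \<omega> *\<^sub>v w) \<bullet>c w)\<bar> \<le> c \<omega> * Re (w \<bullet>c w))"
    by (rule exE)
  have c: "0 \<le> c \<omega>" if "\<omega> \<in> ?\<Omega>" for \<omega> using bspec[OF c' that] by (rule conjunct1)
  have bound: "Im ((D \<omega> *\<^sub>v w) \<bullet>c w) = 0 \<and> \<bar>Re ((D \<omega> *\<^sub>v w) \<bullet>c w)\<bar> \<le> c \<omega> * Re (w \<bullet>c w)"
    if "\<omega> \<in> ?\<Omega>" "w \<in> carrier_vec (n \<omega>)" for \<omega> w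
    using bspec[OF conjunct2[OF bspec[OF c' that(1)]] that(2)] .
  \<comment> \<open>A single step size for all blocks: each \<open>c \<omega>\<close> is at most the
    sum, and the summand 1 keeps the denominator positive when every bound is 0.\<close>
  define s where "s = 1 / (1 + sum c ?\<Omega>)"
  have sum_c: "0 \<le> sum c ?\<Omega>" using c by (rule sum_nonneg)
  have s: "0 < s" using sum_c by (simp add: s_def)
  have sc: "s * c \<omega> \<le> 1" if "\<omega> \<in> ?\<Omega>" for \<omega>
  proof -
    have "c \<omega> \<le> sum c ?\<Omega>" using that c f\<Omega> by (intro member_le_sum) auto
    then show ?thesis using sum_c by (simp add: s_def divide_simps)
  qed
  define Y where "Y \<omega> = mat_adjoint (X \<omega>) * D \<omega> * X \<omega>" for \<omega>
  have Y: "Y \<omega> \<in> carrier_mat (n \<omega>) (n \<omega>)" if "\<omega> \<in> ?\<Omega>" for \<omega>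
    using X'[OF that] D(1)[OF that] by (auto simp: Y_def intro!: mult_carrier_mat)
  have XX: "mat_adjoint (X \<omega>) * X \<omega> \<in> carrier_mat (n \<omega>) (n \<omega>)" if "\<omega> \<in> ?\<Omega>" for \<omega>
    using X'[OF that] by (auto intro!: mult_carrier_mat)
  define B where "B r = (\<lambda>\<omega>\<in>?\<Omega>. mat_adjoint (X \<omega>) * X \<omega> + complex_of_real r \<cdot>\<^sub>m Y \<omega>)" for r
  have A_D: "A \<in> ?D" using extreme unfolding extreme_block_operator_def A_def by (rule conjunct1)
  have B_D: "B r \<in> ?D" if r: "\<bar>r\<bar> = s" for r
  proof -
    have "B r \<in> block_operators ?\<Omega> mI"
      using XX Y by (fastforce simp: block_operators_def B_def)
    moreover have "positive_mat (n \<omega>) (B r \<omega>)" if w: "\<omega> \<in> ?\<Omega>" for \<omega>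
      using positive_mat_perturbation[OF X'[OF w] D(1)[OF w] bound[OF w], of r] sc[OF w] r w
      by (simp add: B_def Y_def)
    \<comment> \<open>The constraints are compared with those of A, which lies in the convex set, so
      their prescribed values never have to be computed.\<close>
    moreover have "(\<Sum>\<omega>\<in>?\<Omega>. mat_trace (S q \<omega> * B r \<omega>)) = (\<Sum>\<omega>\<in>?\<Omega>. mat_trace (S q \<omega> * A \<omega>))"
      if q: "q \<in> Q" for q
    proof -
      have "mat_trace (S q \<omega> * B r \<omega>) = mat_trace (S q \<omega> * A \<omega>) + r * mat_trace (S q \<omega> * Y \<omega>)"
        if w: "\<omega> \<in> ?\<Omega>" for \<omega>
      proof -
        have "S q \<omega> * B r \<omega> = S q \<omega> * A \<omega> + complex_of_real r \<cdot>\<^sub>m (S q \<omega> * Y \<omega>)"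
          using mult_add_distrib_mat[OF S' XX[OF w] smult_carrier_mat[OF Y[OF w]]]
            mult_smult_distrib[OF S' Y[OF w]] w by (simp add: A_def B_def)
        then show ?thesis
          using mat_trace_add[OF mult_carrier_mat[OF S' XX[OF w]]
              smult_carrier_mat[OF mult_carrier_mat[OF S' Y[OF w]]]]
            mat_trace_smult[OF mult_carrier_mat[OF S' Y[OF w]]] w by (simp add: A_def)
      qed
      then show ?thesis using tr[OF q]
        by (simp add: sum.distrib sum_distrib_left[symmetric] Y_def)
    qed
    ultimately show ?thesis using A_D by (fastforce simp: covariant_seeds_def S_def Q_def)
  qed
  \<comment> \<open>The weight is t = 1/2, with 1 - 1/2 left unevaluated to match the definition of
    extremality.\<close>
  have mid: "A = (\<lambda>\<omega>\<in>?\<Omega>. complex_of_real (1 - 1 / 2) \<cdot>\<^sub>m B s \<omega> + complex_of_real (1 / 2) \<cdot>\<^sub>m B (- s) \<omega>)"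
  proof (rule ext)
    fix \<omega>
    show "A \<omega> = (\<lambda>\<omega>\<in>?\<Omega>. complex_of_real (1 - 1 / 2) \<cdot>\<^sub>m B s \<omega> + complex_of_real (1 / 2) \<cdot>\<^sub>m B (- s) \<omega>) \<omega>"
    proof (cases "\<omega> \<in> ?\<Omega>")
      case True
      from XX[OF True] Y[OF True] show ?thesis
        by (auto simp: A_def B_def restrict_apply' True algebra_simps intro!: eq_matI)
    qed (auto simp: A_def)
  qed
  have eq: "B s = B (- s)"
  proof (rule extreme_block_operatorD[OF _ _ _ _ _ mid])
    show "extreme_block_operator ?\<Omega> ?D A" unfolding A_def by (rule extreme)
  qed (use s in \<open>auto intro!: B_D\<close>)
  obtain \<omega> where w: "\<omega> \<in> ?\<Omega>" "Y \<omega> \<noteq> 0\<^sub>m (n \<omega>) (n \<omega>)" using nz by (auto simp: Y_def)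
  \<comment> \<open>The blocks of the two endpoints differ by \<open>2 * s\<close> times
    \<open>Y \<omega>\<close>, and \<open>s\<close> is positive.\<close>
  have "Y \<omega> $$ (i, j) = 0" if "i < n \<omega>" "j < n \<omega>" for i j
  proof -
    have "B s \<omega> $$ (i, j) = B (- s) \<omega> $$ (i, j)" using eq by simp
    then show ?thesis using XX[OF w(1)] Y[OF w(1)] w(1) that s by (simp add: B_def)
  qed
  then have "Y \<omega> = 0\<^sub>m (n \<omega>) (n \<omega>)" using Y[OF w(1)] by (intro eq_matI) auto
  then show False using w(2) by simp
qed

end
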